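(* Let $\omega$ be a radial weight, $0<p<\infty$ and $k\in\mathbb{N}$. Then there exists a constant $C=C(\omega,p,k)>0$ such that $$\int_{\mathbb{D}}|f^{(k)}(z)|^p(1-|z|)^{kp}\omega(z)\,dA(z)+\sum_{j=0}^{k-1}|f^{(j)}(0)|^p\le C\|f\|_{A^p_\omega}^p,\quad f\in\mathcal{H}(\mathbb{D}),$$ if and only if $\omega\in\widehat{\mathcal{D}}$.
   Context: $\mathbb{D}$ is the open unit disc of $\mathbb{C}$, $\mathcal{H}(\mathbb{D})$ the space of analytic functions in $\mathbb{D}$, and $dA(z)=\frac{dx\,dy}{\pi}$. A radial weight is a nonnegative function $\omega\in L^1([0,1))$ extended to $\mathbb{D}$ by $\omega(z)=\omega(|z|)$; it is assumed throughout that $\widehat{\omega}(z)=\int_{|z|}^1\omega(s)\,ds>0$ for all $z\in\mathbb{D}$. $\|f\|_{A^p_\omega}^p=\int_{\mathbb{D}}|f(z)|^p\omega(z)\,dA(z)$ (possibly infinite). $\omega\in\widehat{\mathcal{D}}$ if there is $C\ge1$ with $\widehat{\omega}(r)\le C\widehat{\omega}\left(\frac{1+r}{2}\right)$ for all $0\le r<1$. *)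

theory Defs
  imports "HOL-Complex_Analysis.Complex_Analysis"
begin

(* A radial weight is given by its profile on [0,1); the weight on the unit disc is
   z |-> w (cmod z). Values of w outside [0,1) are irrelevant. *)

definition weight_tail :: "(real \<Rightarrow> real) \<Rightarrow> real \<Rightarrow> real" where
  "weight_tail w r = (LINT s:{r..<1}|lebesgue. w s)"

definition radial_weight :: "(real \<Rightarrow> real) \<Rightarrow> bool" where
  "radial_weight w \<longleftrightarrow>
     (\<forall>r\<in>{0..<1}. 0 \<le> w r) \<and>
     set_integrable lebesgue {0..<1} w \<and>
     (\<forall>z\<in>ball (0::complex) 1. 0 < weight_tail w (cmod z))"

definition upper_doubling :: "(real \<Rightarrow> real) \<Rightarrow> bool" where
  "upper_doubling w \<longleftrightarrow>
     (\<exists>C\<ge>1. \<forall>r\<in>{0..<1}. weight_tail w r \<le> C * weight_tail w ((1 + r) / 2))"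

definition area_measure :: "complex measure" where
  "area_measure = scale_measure (ennreal (1 / pi)) lebesgue"

(* The p-th power of the norm of the weighted Bergman space, possibly infinite. *)
definition bergman_norm_p :: "(real \<Rightarrow> real) \<Rightarrow> real \<Rightarrow> (complex \<Rightarrow> complex) \<Rightarrow> ennreal" where
  "bergman_norm_p w p f =
     (\<integral>\<^sup>+z\<in>ball 0 1. ennreal (cmod (f z) powr p * w (cmod z)) \<partial>area_measure)"

end

theory Submission
  imports Defs
begin

text \<open>
  If \<open>f\<close> is zero free on the boundary of a disc, dividing out its Blaschke factors gives a holomorphic
  \<open>h = g\<^sup>p\<close> without zeros such that \<open>\<bar>f\<bar>\<^sup>p \<le> \<bar>h\<bar>\<close>, with equality on the circle. Applied to \<open>h\<close>,
  Cauchy's formula and the maximum principle show, for every \<open>p > 0\<close>, that \<open>\<bar>f\<bar>\<^sup>p\<close> on a concentric disc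
  of half the radius is at most twice its mean over the circle, and that the circle means of \<open>\<bar>f\<bar>\<^sup>p\<close>
  increase with the radius. Hence the mean of \<open>\<bar>f\<^sup>(\<^sup>k\<^sup>)\<bar>\<^sup>p\<close> over \<open>\<bar>z\<bar> = r\<close>, multiplied by
  \<open>(1 - r)\<^sup>k\<^sup>p\<close>, is at most a multiple of the mean of \<open>\<bar>f\<bar>\<^sup>p\<close> at radius \<open>(1 + r) / 2\<close>. As the means increase, passing
  from \<open>(1 + r) / 2\<close> back to \<open>r\<close> under the integral costs a multiple of the doubling constant.
  Conversely, testing the inequality on \<open>z\<^sup>n\<close> forces at least half of the moment of order \<open>n p\<close> of the weight to
  come from \<open>r \<ge> 1 - A / n\<close>, which compares the tails at \<open>1 - 4 A / n\<close> and \<open>1 - A / n\<close>.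
\<close>

subsection \<open>Rotation invariance and polar integration\<close>

text \<open>For \<open>p < 1\<close> the power is concave, so Jensen's inequality cannot turn
  Cauchy's formula for \<open>f\<close> into a bound on \<open>|f|^p\<close>; for \<open>h\<close>
  the formula already concerns the quantity to be estimated. A zero on the circle itself has no
  Blaschke factor, hence the detour through nearby circles. Normalised area has the Jacobian
  \<open>2 * r\<close>, which separates the radial measure from the tails. It lies between 1 and 2
  once \<open>r \<ge> 1/2\<close>, and that is enough since \<open>(1 + a) / 2\<close> never falls
  below \<open>1/2\<close>. The values at 0 cost the mean at radius \<open>1/2\<close>, which by
  monotonicity is at most the integral of the means divided by the mass of \<open>{1/2..<1}\<close>.
  For \<open>z^n\<close> the derivative side gains a factor of at least
  \<open>(n (1 - r) / 2)^(k p)\<close>. It is at least \<open>2 C\<close> where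
  \<open>r < 1 - A / n\<close>, so at most half of the moment lives there, while
  \<open>r^(n p)\<close> is bounded below on \<open>[1 - 4 A / n, 1)\<close> independently of
  \<open>n\<close>. Of the ratio 4 between the two distances to 1, one factor 2 is the doubling
  itself and the other is lost in rounding to an integer \<open>n\<close>.\<close>

text \<open>The image measure is again translation invariant; convolving both measures with the indicator of
  the unit ball, which has the same mass for both, identifies them.\<close>
lemma lborel_isometry_invariant:
  fixes T :: "'a::euclidean_space \<Rightarrow> 'a"
  assumes lin: "linear T" and norm: "\<And>x. norm (T x) = norm x"
  shows "distr lborel borel T = lborel"
proof -
  define \<mu> where "\<mu> = distr lborel borel T"
  have Tm[measurable]: "T \<in> borel_measurable borel"
    using lin by (simp add: borel_measurable_continuous_onI linear_continuous_on linear_conv_bounded_linear)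
  have sm: "sets \<mu> = sets borel" by (simp add: \<mu>_def)
  have nnd: "(\<integral>\<^sup>+x. f x \<partial>\<mu>) = (\<integral>\<^sup>+x. f (T x) \<partial>lborel)"
    if [measurable]: "f \<in> borel_measurable borel" for f :: "'a \<Rightarrow> ennreal"
    unfolding \<mu>_def by (subst nn_integral_distr) auto
  have vim: "T -` ball 0 r = (ball 0 r :: 'a set)" for r by (auto simp: norm)
  have Tb: "emeasure \<mu> (ball 0 r) = emeasure lborel (ball (0::'a) r)" for r
    unfolding \<mu>_def by (subst emeasure_distr) (auto simp: vim)
  have "inj T"
    unfolding linear_injective_0[OF lin] by (metis norm norm_eq_zero)
  with lin have "surj T" by (rule linear_inj_imp_surj)
  have trl: "(\<integral>\<^sup>+x. f (x + c) \<partial>lborel) = (\<integral>\<^sup>+x. f x \<partial>lborel)"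
    if [measurable]: "f \<in> borel_measurable borel" for f :: "'a \<Rightarrow> ennreal" and c
  proof -
    have "(\<integral>\<^sup>+x. f x \<partial>lborel) = (\<integral>\<^sup>+x. f x \<partial>distr lborel borel ((+) c))"
      by (simp add: lborel_distr_plus)
    also have "\<dots> = (\<integral>\<^sup>+x. f (x + c) \<partial>lborel)"
      by (subst nn_integral_distr) (auto simp: add.commute)
    finally show ?thesis by simp
  qed
  have trm: "(\<integral>\<^sup>+x. f (x + c) \<partial>\<mu>) = (\<integral>\<^sup>+x. f x \<partial>\<mu>)"
    if [measurable]: "f \<in> borel_measurable borel" for f :: "'a \<Rightarrow> ennreal" and c
  proof -
    \<comment> \<open>Translating the image by \<open>c = T d\<close> amounts to translating the
      source by \<open>d\<close>, so \<open>trl\<close> carries over to the image measure.\<close>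
    obtain d where d: "c = T d" using \<open>surj T\<close> by (meson surjD)
    have "(\<integral>\<^sup>+x. f (x + c) \<partial>\<mu>) = (\<integral>\<^sup>+x. f (T (x + d)) \<partial>lborel)"
      by (subst nnd) (auto simp: d linear_add[OF lin])
    also have "\<dots> = (\<integral>\<^sup>+x. f (T x) \<partial>lborel)" by (rule trl[of "\<lambda>x. f (T x)"]) simp
    also have "\<dots> = (\<integral>\<^sup>+x. f x \<partial>\<mu>)" by (simp add: nnd)
    finally show ?thesis .
  qed
  interpret \<mu>: sigma_finite_measure \<mu>
  proof (unfold_locales, intro exI conjI ballI)
    let ?A = "range (\<lambda>n::nat. ball 0 (real n) :: 'a set)"
    show "countable ?A" "?A \<subseteq> sets \<mu>" by (auto simp: sm)
    have "\<exists>n::nat. x \<in> ball 0 (real n)" for x :: 'a using reals_Archimedean2[of "norm x"] by simp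
    then show "\<Union>?A = space \<mu>" by (fastforce simp: \<mu>_def)
    show "emeasure \<mu> a \<noteq> \<infinity>" if "a \<in> ?A" for a
      using that by (auto simp: Tb emeasure_ball)
  qed
  interpret P: pair_sigma_finite lborel \<mu> ..
  have [measurable_cong]: "sets \<mu> = sets borel" by (rule sm)
  have key: "(\<integral>\<^sup>+x. f x \<partial>lborel) = (\<integral>\<^sup>+x. f x \<partial>\<mu>)"
    if [measurable]: "f \<in> borel_measurable borel" for f :: "'a \<Rightarrow> ennreal"
  proof -
    let ?B = "ball 0 1 :: 'a set"
    let ?b = "emeasure lborel ?B"
    have [measurable]: "?B \<in> sets borel" by simp
    have "(\<integral>\<^sup>+x. f x \<partial>lborel) * ?b = (\<integral>\<^sup>+y. (\<integral>\<^sup>+x. f x \<partial>lborel) * indicator ?B y \<partial>\<mu>)"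
      by (simp add: nn_integral_cmult_indicator sm Tb)
    also have "\<dots> = (\<integral>\<^sup>+y. (\<integral>\<^sup>+x. f (x + y) * indicator ?B y \<partial>lborel) \<partial>\<mu>)"
      by (subst nn_integral_multc) (auto simp: trl)
    also have "\<dots> = (\<integral>\<^sup>+x. (\<integral>\<^sup>+y. f (x + y) * indicator ?B y \<partial>\<mu>) \<partial>lborel)"
      by (rule P.Fubini') measurable
    also have "\<dots> = (\<integral>\<^sup>+x. (\<integral>\<^sup>+y. f y * indicator ?B (y - x) \<partial>\<mu>) \<partial>lborel)"
    proof (rule nn_integral_cong)
      fix x show "(\<integral>\<^sup>+y. f (x + y) * indicator ?B y \<partial>\<mu>) = (\<integral>\<^sup>+y. f y * indicator ?B (y - x) \<partial>\<mu>)"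
        using trm[of "\<lambda>y. f y * indicator ?B (y - x)" x] by (simp add: add.commute)
    qed
    also have "\<dots> = (\<integral>\<^sup>+y. (\<integral>\<^sup>+x. f y * indicator ?B (y - x) \<partial>lborel) \<partial>\<mu>)"
      by (rule P.Fubini'[symmetric]) measurable
    also have "\<dots> = (\<integral>\<^sup>+y. f y * ?b \<partial>\<mu>)"
    proof (rule nn_integral_cong)
      fix y
      have "(\<integral>\<^sup>+x. indicator ?B (y - x) \<partial>lborel) = (\<integral>\<^sup>+x. indicator (ball y 1) x \<partial>lborel)"
        by (intro nn_integral_cong) (auto simp: indicator_def dist_norm norm_minus_commute)
      also have "\<dots> = ?b" by (simp add: emeasure_ball)
      finally show "(\<integral>\<^sup>+x. f y * indicator ?B (y - x) \<partial>lborel) = f y * ?b"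
        by (subst nn_integral_cmult) auto
    qed
    also have "\<dots> = (\<integral>\<^sup>+y. f y \<partial>\<mu>) * ?b" by (rule nn_integral_multc) simp
    finally have "?b * (\<integral>\<^sup>+x. f x \<partial>lborel) = ?b * (\<integral>\<^sup>+x. f x \<partial>\<mu>)"
      by (simp add: mult.commute)
    \<comment> \<open>Cancellation in \<open>ennreal\<close> needs the mass of the unit ball to be
      positive and finite.\<close>
    moreover have "0 < unit_ball_vol (real DIM('a))"
      by (simp add: unit_ball_vol_def Gamma_real_pos)
    then have "?b \<noteq> 0" "?b \<noteq> top" by (simp_all add: emeasure_ball order_less_imp_not_eq2)
    ultimately show ?thesis by (simp add: ennreal_mult_cancel_left)
  qed
  have "\<mu> = lborel"
  proof (rule measure_eqI)
    show "sets \<mu> = sets lborel" by (simp add: sm)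
    fix A assume "A \<in> sets \<mu>"
    then have "A \<in> sets borel" by (simp add: sm)
    then show "emeasure \<mu> A = emeasure lborel A"
      using key[of "indicator A"] sm by simp
  qed
  then show ?thesis by (simp add: \<mu>_def)
qed

text \<open>Half-lines \<open>{..<r}\<close> generate the Borel sets and determine both measures;
  the area \<open>pi * r^2\<close> of a disc has the density on the right as its derivative.\<close>

lemma distr_lborel_cmod:
  "distr lborel borel cmod = density lborel (\<lambda>r. ennreal (2 * pi * r) * indicator {0<..} r)"
    (is "?M = ?N")
proof (rule measure_eqI_generator_eq[where E="range lessThan" and A="\<lambda>n. {..<real n}" and \<Omega>=UNIV])
  show "Int_stable (range lessThan :: real set set)"
    by (auto simp: Int_stable_def greaterThan_Int_greaterThan)
  show "sets ?M = sigma_sets UNIV (range lessThan)" "sets ?N = sigma_sets UNIV (range lessThan)"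
    by (simp_all add: borel_Iio)
  have eq: "emeasure ?M {..<r} = ennreal (pi * (max r 0)\<^sup>2)" for r
  proof -
    have "emeasure ?M {..<r} = emeasure lborel (ball (0::complex) r)"
      by (subst emeasure_distr) (auto intro!: arg_cong2[where f=emeasure])
    also have "\<dots> = ennreal (pi * (max r 0)\<^sup>2)"
      by (cases "r \<ge> 0") (auto simp: emeasure_ball unit_ball_vol_2 max_def ball_empty)
    finally show ?thesis .
  qed
  show "emeasure ?M X = emeasure ?N X" if X: "X \<in> range lessThan" for X
  proof -
    obtain r where r: "X = {..<r}" using X by auto
    have "emeasure ?N X = (\<integral>\<^sup>+x. ennreal (2 * pi * x) * indicator {0..max r 0} x \<partial>lborel)"
      unfolding r
    proof (subst emeasure_density)
      show "(\<integral>\<^sup>+x. ennreal (2 * pi * x) * indicator {0<..} x * indicator {..<r} x \<partial>lborel) =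
          (\<integral>\<^sup>+x. ennreal (2 * pi * x) * indicator {0..max r 0} x \<partial>lborel)"
      proof (rule nn_integral_cong_AE)
        show "AE x in lborel. ennreal (2 * pi * x) * indicator {0<..} x * indicator {..<r} x =
            ennreal (2 * pi * x) * indicator {0..max r 0} x"
          using AE_lborel_singleton[of r] AE_lborel_singleton[of 0]
          by eventually_elim (auto simp: indicator_def)
      qed
    qed auto
    also have "\<dots> = ennreal (pi * (max r 0)\<^sup>2 - pi * 0\<^sup>2)"
      by (rule nn_integral_FTC_Icc[where F="\<lambda>x. pi * x\<^sup>2"])
         (auto intro!: derivative_eq_intros)
    finally show ?thesis by (simp add: r eq)
  qed
  show "(\<Union>i. {..<real i}) = UNIV" using reals_Archimedean2 by auto
  show "emeasure ?M {..<real i} \<noteq> \<infinity>" for i by (simp add: eq)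
qed auto

lemma nn_integral_radial:
  assumes [measurable]: "g \<in> borel_measurable borel"
  shows "(\<integral>\<^sup>+z. g (cmod z) \<partial>lborel) = (\<integral>\<^sup>+r. ennreal (2 * pi * r) * indicator {0<..} r * g r \<partial>lborel)"
proof -
  have "(\<integral>\<^sup>+z. g (cmod z) \<partial>lborel) = (\<integral>\<^sup>+r. g r \<partial>distr lborel borel cmod)"
    by (subst nn_integral_distr) auto
  then show ?thesis unfolding distr_lborel_cmod
    by (simp add: nn_integral_density)
qed

text \<open>The parameter runs over \<open>[0, 1]\<close>, so means carry no normalising factor and
  the curve agrees with \<open>circlepath\<close>.\<close>

definition ucirc :: "real \<Rightarrow> complex" where "ucirc t = cis (2 * pi * t)"

lemma ucirc_norm[simp]: "cmod (ucirc t) = 1" by (simp add: ucirc_def)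
lemma ucirc_add: "ucirc (s + t) = ucirc s * ucirc t" by (simp add: ucirc_def cis_mult ring_distribs)
lemma ucirc_1[simp]: "ucirc 1 = 1" by (simp add: ucirc_def)
lemma continuous_ucirc[continuous_intros]:
  "continuous_on S f \<Longrightarrow> continuous_on S (\<lambda>x. ucirc (f x))"
  unfolding ucirc_def by (intro continuous_intros)
lemma measurable_ucirc[measurable]: "ucirc \<in> borel_measurable borel"
  by (intro borel_measurable_continuous_onI continuous_intros)

lemma ucirc_surj: "\<exists>t\<in>{0..<1}. z = of_real (cmod z) * ucirc t"
proof -
  define s where "s = Arg2pi z / (2 * pi)"
  have "z = of_real (cmod z) * ucirc s"
    using Arg2pi_eq[of z] by (simp add: ucirc_def s_def cis_conv_exp)
  moreover have "s \<in> {0..<1}"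
    using Arg2pi_ge_0[of z] Arg2pi_lt_2pi[of z] by (auto simp: s_def field_simps)
  ultimately show ?thesis by blast
qed

text \<open>The values are in \<open>ennreal\<close>, so Tonelli applies without integrability
  conditions. The argument is a point of the circle, not a radius, which allows means based at
  \<open>r + s * ucirc t\<close>.\<close>

definition cmean :: "(complex \<Rightarrow> ennreal) \<Rightarrow> complex \<Rightarrow> ennreal" where
  "cmean F z = (\<integral>\<^sup>+t\<in>{0..1}. F (z * ucirc t) \<partial>lborel)"

text \<open>Moving the base point along its circle translates the parameter of a 1-periodic
  function; the part pushed beyond 1 wraps around to the start.\<close>

lemma cmean_cmod:
  assumes [measurable]: "F \<in> borel_measurable borel"
  shows "cmean F z = cmean F (of_real (cmod z))"
proof -
  obtain s where s: "0 \<le> s" "s < 1" and z: "z = of_real (cmod z) * ucirc s" using ucirc_surj[of z] by auto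
  define G where "G t = F (of_real (cmod z) * ucirc t)" for t
  have [measurable]: "G \<in> borel_measurable borel" unfolding G_def by simp
  have per: "G (t + 1) = G t" for t by (simp add: G_def ucirc_add)
  have shift: "(\<integral>\<^sup>+t. H t \<partial>lborel) = (\<integral>\<^sup>+t. H (t + c) \<partial>lborel)"
    if "H \<in> borel_measurable borel" for H :: "real \<Rightarrow> ennreal" and c
    using nn_integral_real_affine[OF that, of 1 c] by (simp add: add.commute)
  have "cmean F z = (\<integral>\<^sup>+t. G (t + s) * indicator {0..1} t \<partial>lborel)"
    unfolding cmean_def G_def by (subst z) (simp add: ucirc_add mult_ac)
  also have "\<dots> = (\<integral>\<^sup>+t. G t * indicator {s..1+s} t \<partial>lborel)"
    by (subst (2) shift[of _ s]) (auto intro!: nn_integral_cong simp: indicator_def)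
  also have "\<dots> = (\<integral>\<^sup>+t. G t * indicator {s..<1} t + G t * indicator {1..1+s} t \<partial>lborel)"
    using s by (intro nn_integral_cong) (auto simp: indicator_def)
  also have "\<dots> = (\<integral>\<^sup>+t. G t * indicator {s..<1} t \<partial>lborel) + (\<integral>\<^sup>+t. G t * indicator {1..1+s} t \<partial>lborel)"
    by (rule nn_integral_add) auto
  also have "(\<integral>\<^sup>+t. G t * indicator {1..1+s} t \<partial>lborel) = (\<integral>\<^sup>+t. G t * indicator {0..s} t \<partial>lborel)"
    by (subst shift[of _ 1]) (auto intro!: nn_integral_cong simp: indicator_def per)
  also have "(\<integral>\<^sup>+t. G t * indicator {s..<1} t \<partial>lborel) + (\<integral>\<^sup>+t. G t * indicator {0..s} t \<partial>lborel)
     = (\<integral>\<^sup>+t. G t * indicator {s..<1} t + G t * indicator {0..s} t \<partial>lborel)"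
    by (rule nn_integral_add[symmetric]) auto
  also have "\<dots> = (\<integral>\<^sup>+t. G t * indicator {0..1} t \<partial>lborel)"
  proof (rule nn_integral_cong_AE)
    show "AE t in lborel. G t * indicator {s..<1} t + G t * indicator {0..s} t = G t * indicator {0..1} t"
      using AE_lborel_singleton[of s] AE_lborel_singleton[of 1]
      by eventually_elim (use s in \<open>auto simp: indicator_def\<close>)
  qed
  finally show ?thesis by (simp add: cmean_def G_def)
qed

text \<open>By rotation invariance the integral equals its average over all rotations. Tonelli moves
  the average inside, where it meets \<open>F\<close> only, as \<open>g (cmod z)\<close> does not
  change under rotation.\<close>

lemma nn_integral_rotation_average:
  assumes [measurable]: "F \<in> borel_measurable borel" "g \<in> borel_measurable borel"
  shows "(\<integral>\<^sup>+z. F z * g (cmod z) \<partial>lborel) = (\<integral>\<^sup>+z. cmean F z * g (cmod z) \<partial>lborel)"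
proof -
  have rot: "(\<integral>\<^sup>+z. F z * g (cmod z) \<partial>lborel) = (\<integral>\<^sup>+z. F (z * ucirc t) * g (cmod z) \<partial>lborel)" for t
  proof -
    have "(\<integral>\<^sup>+z. F z * g (cmod z) \<partial>lborel) = (\<integral>\<^sup>+z. F z * g (cmod z) \<partial>distr lborel borel (\<lambda>z. z * ucirc t))"
      by (subst lborel_isometry_invariant)
         (auto simp: norm_mult intro!: bounded_linear.linear bounded_linear_mult_left)
    also have "\<dots> = (\<integral>\<^sup>+z. F (z * ucirc t) * g (cmod z) \<partial>lborel)"
      by (subst nn_integral_distr) (auto simp: norm_mult)
    finally show ?thesis .
  qed
  have "(\<integral>\<^sup>+z. F z * g (cmod z) \<partial>lborel) = (\<integral>\<^sup>+t. (\<integral>\<^sup>+z. F z * g (cmod z) \<partial>lborel) * indicator {0..1::real} t \<partial>lborel)"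
    by (subst nn_integral_cmult) auto
  also have "\<dots> = (\<integral>\<^sup>+t. (\<integral>\<^sup>+z. F (z * ucirc t) * g (cmod z) * indicator {0..1::real} t \<partial>lborel) \<partial>lborel)"
    by (subst nn_integral_multc) (auto simp: rot[symmetric])
  also have "\<dots> = (\<integral>\<^sup>+z. (\<integral>\<^sup>+t. F (z * ucirc t) * g (cmod z) * indicator {0..1::real} t \<partial>lborel) \<partial>lborel)"
    by (rule lborel_pair.Fubini') measurable
  also have "\<dots> = (\<integral>\<^sup>+z. cmean F z * g (cmod z) \<partial>lborel)"
    unfolding cmean_def
    by (intro nn_integral_cong, subst nn_integral_multc[symmetric]) (auto simp: mult_ac)
  finally show ?thesis .
qed

lemma cmean_measurable[measurable]:
  assumes [measurable]: "F \<in> borel_measurable borel"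
  shows "cmean F \<in> borel_measurable borel"
  unfolding cmean_def by measurable

lemma nn_integral_polar:
  assumes [measurable]: "F \<in> borel_measurable borel" "g \<in> borel_measurable borel"
  shows "(\<integral>\<^sup>+z. F z * g (cmod z) \<partial>lborel) =
     (\<integral>\<^sup>+r. ennreal (2 * pi * r) * indicator {0<..} r * (cmean F (of_real r) * g r) \<partial>lborel)"
    (is "_ = ?R")
proof -
  have "(\<integral>\<^sup>+z. F z * g (cmod z) \<partial>lborel) = (\<integral>\<^sup>+z. cmean F (of_real (cmod z)) * g (cmod z) \<partial>lborel)"
    unfolding nn_integral_rotation_average[OF assms] by (subst cmean_cmod) auto
  also have "\<dots> = ?R" by (rule nn_integral_radial) simp
  finally show ?thesis .
qed

subsection \<open>Circle means of powers of holomorphic functions\<close>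

text \<open>The quotient of the two sides is the Blaschke factor of \<open>a\<close> for the disc of
  radius \<open>R\<close>. Everything is read off the identity \<open>id\<close>, whose right side
  is nonnegative in the disc and 0 on the circle.\<close>

lemma blaschke_factor_compare:
  fixes a w :: complex
  assumes "0 < R" "cmod a < R"
  shows "cmod w \<le> R \<Longrightarrow> cmod (w - a) \<le> cmod ((of_real (R\<^sup>2) - cnj a * w) / of_real R)"
    and "cmod w = R \<Longrightarrow> cmod (w - a) = cmod ((of_real (R\<^sup>2) - cnj a * w) / of_real R)"
    and "cmod w \<le> R \<Longrightarrow> of_real (R\<^sup>2) - cnj a * w \<noteq> 0"
proof -
  have id: "(cmod (of_real (R\<^sup>2) - cnj a * w))\<^sup>2 - R\<^sup>2 * (cmod (w - a))\<^sup>2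
      = (R\<^sup>2 - (cmod a)\<^sup>2) * (R\<^sup>2 - (cmod w)\<^sup>2)"
    unfolding cmod_power2 by (simp add: algebra_simps power2_eq_square)
  have eq: "(cmod ((of_real (R\<^sup>2) - cnj a * w) / of_real R))\<^sup>2 - (cmod (w - a))\<^sup>2
      = (R\<^sup>2 - (cmod a)\<^sup>2) * (R\<^sup>2 - (cmod w)\<^sup>2) / R\<^sup>2"
    using id assms by (simp add: norm_divide power_divide field_simps)
  have a: "0 < R\<^sup>2 - (cmod a)\<^sup>2" using assms by (simp add: power_strict_mono)
  show "cmod (w - a) \<le> cmod ((of_real (R\<^sup>2) - cnj a * w) / of_real R)" if "cmod w \<le> R"
  proof -
    have "0 \<le> R\<^sup>2 - (cmod w)\<^sup>2" using that by (simp add: power_mono)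
    then have "0 \<le> (R\<^sup>2 - (cmod a)\<^sup>2) * (R\<^sup>2 - (cmod w)\<^sup>2) / R\<^sup>2" using a by simp
    then have "(cmod (w - a))\<^sup>2 \<le> (cmod ((of_real (R\<^sup>2) - cnj a * w) / of_real R))\<^sup>2" using eq by linarith
    then show ?thesis by (rule power2_le_imp_le) simp
  qed
  show "cmod (w - a) = cmod ((of_real (R\<^sup>2) - cnj a * w) / of_real R)" if "cmod w = R"
  proof -
    have "(cmod (w - a))\<^sup>2 = (cmod ((of_real (R\<^sup>2) - cnj a * w) / of_real R))\<^sup>2" using eq that by simp
    then show ?thesis by (rule power2_eq_imp_eq) auto
  qed
  show "of_real (R\<^sup>2) - cnj a * w \<noteq> 0" if "cmod w \<le> R"
  proof
    assume "of_real (R\<^sup>2) - cnj a * w = 0"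
    then have "cmod (cnj a * w) = R\<^sup>2"
      by (metis norm_of_real abs_power2 eq_iff_diff_eq_0 abs_of_nonneg zero_le_power2)
    moreover have "cmod (cnj a * w) < R * R"
      unfolding norm_mult complex_mod_cnj
      using assms that mult_left_mono[of "cmod w" R "cmod a"] mult_strict_right_mono[of "cmod a" R R]
      by (meson le_less_trans norm_ge_zero)
    ultimately show False by (simp add: power2_eq_square)
  qed
qed

text \<open>Induction on the number of distinct zeros: each factor \<open>w - a\<close> is exchanged
  for one that is larger in the disc, equal in modulus on the circle, and whose own zero lies
  outside the closed disc.\<close>

lemma zero_free_majorant:
  assumes "f holomorphic_on ball 0 R'" "0 < R" "R < R'"
    and "finite {z \<in> ball 0 R. f z = 0}" "\<And>z. cmod z = R \<Longrightarrow> f z \<noteq> 0"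
  shows "\<exists>g. g holomorphic_on ball 0 R' \<and> (\<forall>z\<in>cball 0 R. g z \<noteq> 0 \<and> cmod (f z) \<le> cmod (g z)) \<and>
     (\<forall>z. cmod z = R \<longrightarrow> cmod (f z) = cmod (g z))"
  using assms
proof (induction "card {z \<in> ball 0 R. f z = 0}" arbitrary: f)
  case 0
  then have "{z \<in> ball 0 R. f z = 0} = {}" by auto
  with 0 have "f z \<noteq> 0" if "cmod z \<le> R" for z using that by (cases "cmod z = R") auto
  with 0 show ?case by (intro exI[of _ f]) auto
next
  case (Suc n f)
  let ?S = "ball (0::complex) R'"
  have "{z \<in> ball 0 R. f z = 0} \<noteq> {}"
    using Suc.hyps(2) by (metis card.empty nat.distinct(1))
  then obtain a where a: "a \<in> ball 0 R" "f a = 0" by blast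
  have aS: "a \<in> ?S" using a Suc.prems(3) by auto
  \<comment> \<open>A constant \<open>f\<close> would vanish at \<open>R\<close> since it vanishes
    at \<open>a\<close>. Being non-constant, \<open>f\<close> has a zero of finite order
    \<open>m\<close> at \<open>a\<close>.\<close>
  have nc: "\<not> f constant_on ?S"
  proof
    assume "f constant_on ?S"
    then have "f (of_real R) = f a" using aS Suc.prems unfolding constant_on_def by (metis abs_of_pos mem_ball_0 norm_of_real)
    then show False using a Suc.prems(5)[of "of_real R"] Suc.prems(2) by simp
  qed
  obtain g r m where g: "0 < m" "0 < r" "ball a r \<subseteq> ?S" "g holomorphic_on ball a r"
      "\<And>w. w \<in> ball a r \<Longrightarrow> f w = (w - a) ^ m * g w" "\<And>w. w \<in> ball a r \<Longrightarrow> g w \<noteq> 0"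
    using holomorphic_factor_zero_nonconstant[OF Suc.prems(1) open_ball connected_ball aS a(2) nc] by metis
  define F where "F w = (if w = a then g a else f w / (w - a) ^ m)" for w
  have F_eq: "f w = F w * (w - a) ^ m" for w using a g by (auto simp: F_def)
  have "F holomorphic_on (ball a r \<union> (?S - {a}))"
  proof (rule holomorphic_on_Un)
    show "F holomorphic_on ball a r"
      using g(4) by (rule holomorphic_transform) (use g in \<open>auto simp: F_def\<close>)
    have "(\<lambda>w. f w / (w - a) ^ m) holomorphic_on (?S - {a})"
      using Suc.prems(1) by (auto intro!: holomorphic_intros elim: holomorphic_on_subset)
    then show "F holomorphic_on (?S - {a})"
      by (rule holomorphic_transform) (auto simp: F_def)
  qed auto
  moreover have "ball a r \<union> (?S - {a}) = ?S" using g(2,3) by auto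
  ultimately have F_hol: "F holomorphic_on ?S" by simp
  have F_a: "F a \<noteq> 0" using g by (auto simp: F_def)
  have F_0: "F w = 0 \<longleftrightarrow> f w = 0 \<and> w \<noteq> a" for w using F_a F_eq[of w] by auto
  define B where "B w = (of_real (R\<^sup>2) - cnj a * w) / of_real R" for w
  have ca: "cmod a < R" using a by simp
  note bl = blaschke_factor_compare[OF Suc.prems(2) ca, folded B_def]
  have B0: "B w \<noteq> 0" if "cmod w \<le> R" for w
    using bl(3)[OF that] Suc.prems(2) by (simp add: B_def)
  define f1 where "f1 w = F w * B w ^ m" for w
  have f1_0: "f1 w = 0 \<longleftrightarrow> f w = 0 \<and> w \<noteq> a" if "cmod w \<le> R" for w
    using B0[OF that] F_0 by (simp add: f1_def)
  \<comment> \<open>The zero is removed with its whole multiplicity, so the count of distinct zeros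
    drops by exactly one.\<close>
  have Z: "{z \<in> ball 0 R. f1 z = 0} = {z \<in> ball 0 R. f z = 0} - {a}"
    using f1_0 by auto
  have "\<exists>g. g holomorphic_on ball 0 R' \<and> (\<forall>z\<in>cball 0 R. g z \<noteq> 0 \<and> cmod (f1 z) \<le> cmod (g z)) \<and>
     (\<forall>z. cmod z = R \<longrightarrow> cmod (f1 z) = cmod (g z))"
  proof (rule Suc.hyps(1))
    show "n = card {z \<in> ball 0 R. f1 z = 0}" unfolding Z
      using Suc.hyps(2) a Suc.prems(4) by simp
    show "f1 holomorphic_on ball 0 R'"
      unfolding f1_def B_def using F_hol Suc.prems(2) by (auto intro!: holomorphic_intros)
    show "finite {z \<in> ball 0 R. f1 z = 0}" unfolding Z using Suc.prems(4) by simp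
    show "f1 z \<noteq> 0" if "cmod z = R" for z using f1_0[of z] that Suc.prems(5)[OF that] by auto
  qed (use Suc.prems in auto)
  then obtain k where k: "k holomorphic_on ball 0 R'"
     "\<forall>z\<in>cball 0 R. k z \<noteq> 0 \<and> cmod (f1 z) \<le> cmod (k z)"
     "\<forall>z. cmod z = R \<longrightarrow> cmod (f1 z) = cmod (k z)" by blast
  have "cmod (f z) \<le> cmod (f1 z)" if "cmod z \<le> R" for z
    unfolding f1_def F_eq[of z] norm_mult norm_power
    using bl(1)[OF that] by (intro mult_left_mono power_mono) auto
  moreover have "cmod (f z) = cmod (f1 z)" if "cmod z = R" for z
    unfolding f1_def F_eq[of z] norm_mult norm_power using bl(2)[OF that] by simp
  ultimately show ?case using k by (intro exI[of _ k]) (force simp: order_trans)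
qed

lemma cball_subset_open_imp_ball_subset:
  fixes V :: "complex set"
  assumes "open V" "cball 0 R \<subseteq> V" "0 < R"
  obtains R' where "R < R'" "ball 0 R' \<subseteq> V"
proof -
  obtain e where e: "e > 0" "(\<Union>x\<in>cball 0 R. ball x e) \<subseteq> V"
    using compact_subset_open_imp_ball_epsilon_subset[of "cball 0 R" V] assms by auto
  have "z \<in> V" if z: "z \<in> ball 0 (R + e)" for z
  proof (cases "cmod z \<le> R")
    case True then show ?thesis using assms by auto
  next
    case False
    \<comment> \<open>The radial projection of \<open>z\<close> onto the circle, at distance
      \<open>cmod z - R < e\<close>.\<close>
    let ?x = "of_real (R / cmod z) * z"
    have "0 < cmod z" using False assms(3) by linarith
    have "cmod ?x = R" using False assms by (auto simp: norm_mult norm_divide)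
    have "z - ?x = of_real (1 - R / cmod z) * z" by (simp add: algebra_simps)
    moreover have "0 \<le> 1 - R / cmod z" using False \<open>0 < cmod z\<close> by (simp add: divide_le_eq_1)
    ultimately have "cmod (z - ?x) = (1 - R / cmod z) * cmod z"
      by (simp only: norm_mult norm_of_real abs_of_nonneg)
    also have "\<dots> = cmod z - R" using \<open>0 < cmod z\<close> by (simp add: field_simps)
    finally have "dist ?x z < e" using z by (simp add: dist_norm norm_minus_commute)
    then have "z \<in> ball ?x e" "?x \<in> cball 0 R" using \<open>cmod ?x = R\<close> by auto
    then show ?thesis using e by blast
  qed
  then show thesis using e by (intro that[of "R + e"]) auto
qed

text \<open>On a disc a zero free \<open>g\<close> has a logarithm \<open>L\<close>, and
  \<open>exp (p * L)\<close> is a holomorphic branch of the \<open>p\<close>-th power for arbitrary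
  real \<open>p > 0\<close>.\<close>

lemma zero_free_power_majorant:
  assumes f: "f holomorphic_on ball 0 R'" and R: "0 < R" "R < R'"
    and nz: "\<And>z. cmod z = R \<Longrightarrow> f z \<noteq> 0" and p: "0 < p"
  obtains h R'' where "R < R''" "h holomorphic_on ball 0 R''" "\<And>z. z \<in> ball 0 R'' \<Longrightarrow> h z \<noteq> 0"
    "\<And>z. cmod z \<le> R \<Longrightarrow> cmod (f z) powr p \<le> cmod (h z)"
    "\<And>z. cmod z = R \<Longrightarrow> cmod (f z) powr p = cmod (h z)"
proof -
  have "finite {z \<in> cball 0 R. f z = 0}"
  proof (cases "f constant_on ball 0 R'")
    case True
    then obtain c where c: "\<And>z. z \<in> ball 0 R' \<Longrightarrow> f z = c" unfolding constant_on_def by blast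
    have "c \<noteq> 0" using c[of "of_real R"] nz[of "of_real R"] R by simp
    then have "{z \<in> cball 0 R. f z = 0} = {}" using c R by fastforce
    then show ?thesis by (metis finite.emptyI)
  next
    case False
    show ?thesis
      by (rule holomorphic_compact_finite_zeros[OF f open_ball connected_ball compact_cball _ False]) (use R in auto)
  qed
  then have fin: "finite {z \<in> ball 0 R. f z = 0}"
    by (rule rev_finite_subset) auto
  obtain g where g: "g holomorphic_on ball 0 R'" "\<And>z. cmod z \<le> R \<Longrightarrow> g z \<noteq> 0"
     "\<And>z. cmod z \<le> R \<Longrightarrow> cmod (f z) \<le> cmod (g z)" "\<And>z. cmod z = R \<Longrightarrow> cmod (f z) = cmod (g z)"
    using zero_free_majorant[OF f R fin nz] by auto
  \<comment> \<open>The majorant \<open>g\<close> may vanish beyond the closed disc; a slightly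
    larger disc without zeros is needed for the logarithm.\<close>
  let ?V = "ball 0 R' \<inter> g -` (- {0})"
  have "open ?V"
    using holomorphic_on_imp_continuous_on[OF g(1)] by (intro continuous_open_preimage) auto
  moreover have "cball 0 R \<subseteq> ?V" using g R by auto
  ultimately obtain R'' where R'': "R < R''" "ball 0 R'' \<subseteq> ?V"
    using cball_subset_open_imp_ball_subset R by metis
  obtain L where L: "L holomorphic_on ball 0 R''" "\<And>z. z \<in> ball 0 R'' \<Longrightarrow> g z = exp (L z)"
  proof (rule contractible_imp_holomorphic_log)
    show "g holomorphic_on ball 0 R''" using g(1) by (rule holomorphic_on_subset) (use R'' in auto)
    show "contractible (ball (0::complex) R'')" by (intro convex_imp_contractible convex_ball)
    show "g z \<noteq> 0" if "z \<in> ball 0 R''" for z using that R'' by auto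
  qed blast
  let ?h = "\<lambda>z. exp (of_real p * L z)"
  have h: "cmod (?h z) = cmod (g z) powr p" if "z \<in> ball 0 R''" for z
    using L(2)[OF that] by (simp add: powr_def)
  show thesis
  proof (rule that[of R'' ?h])
    show "?h holomorphic_on ball 0 R''" using L by (auto intro!: holomorphic_intros)
    show "cmod (f z) powr p \<le> cmod (?h z)" if "cmod z \<le> R" for z
      using g(3)[OF that] h[of z] that R'' p by (auto intro: powr_mono2)
    show "cmod (f z) powr p = cmod (?h z)" if "cmod z = R" for z
      using g(4)[OF that] h[of z] that R'' by auto
  qed (use R'' in auto)
qed

section \<open>Cauchy's formula and real-valued circle means\<close>

lemma continuous_on_circle:
  assumes "continuous_on (ball 0 R) G" "cmod z < R"
  shows "continuous_on {0..1} (\<lambda>t. G (z * ucirc t))"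
  by (rule continuous_on_compose2[OF assms(1)]) (use assms(2) in \<open>auto intro!: continuous_intros simp: norm_mult\<close>)

text \<open>The 2 bounds the Cauchy kernel: \<open>u\<close> keeps distance at least
  \<open>R / 2\<close> from the circle, so \<open>R / cmod (v - u) \<le> 2\<close> for
  \<open>v\<close> on it.\<close>

lemma holomorphic_half_disc_bound:
  assumes h: "h holomorphic_on ball 0 R'" and R: "0 < R" "R < R'" and u: "cmod u \<le> R / 2"
  shows "cmod (h u) \<le> 2 * integral {0..1} (\<lambda>t. cmod (h (of_real R * ucirc t)))"
proof -
  have cont: "continuous_on (ball 0 R') h" using h by (rule holomorphic_on_imp_continuous_on)
  have "((\<lambda>v. h v / (v - u)) has_contour_integral (2 * of_real pi * \<i> * h u)) (circlepath 0 R)"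
  proof (rule Cauchy_integral_circlepath)
    show "continuous_on (cball 0 R) h" using cont by (rule continuous_on_subset) (use R in auto)
    show "h holomorphic_on ball 0 R" using h by (rule holomorphic_on_subset) (use R in auto)
  qed (use u R in auto)
  then have "((\<lambda>t. h (of_real R * ucirc t) / (of_real R * ucirc t - u) * (2 * pi * \<i> * R * ucirc t))
      has_integral (2 * of_real pi * \<i> * h u)) {0..1}"
    unfolding has_contour_integral_def
  proof (rule has_integral_eq[rotated])
    fix t :: real assume "t \<in> {0..1}"
    then have "vector_derivative (circlepath 0 R) (at t within {0..1}) = 2 * pi * \<i> * R * ucirc t"
      by (simp add: vector_derivative_circlepath01 ucirc_def cis_conv_exp mult_ac)
    moreover have "circlepath 0 R t = of_real R * ucirc t"
      by (simp add: circlepath ucirc_def cis_conv_exp mult_ac)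
    ultimately show "h (circlepath 0 R t) / (circlepath 0 R t - u) *
        vector_derivative (circlepath 0 R) (at t within {0..1}) =
        h (of_real R * ucirc t) / (of_real R * ucirc t - u) * (2 * pi * \<i> * R * ucirc t)" by simp
  qed
  from has_integral_mult_right[OF this, of "1 / (2 * of_real pi * \<i>)"]
  have I: "((\<lambda>t. h (of_real R * ucirc t) / (of_real R * ucirc t - u) * (R * ucirc t))
      has_integral h u) {0..1}"
    by (simp add: field_simps)
  have "(\<lambda>t. cmod (h (of_real R * ucirc t))) integrable_on {0..1}"
    using R by (intro integrable_continuous_real continuous_intros continuous_on_circle[OF cont]) auto
  then have J: "((\<lambda>t. 2 * cmod (h (of_real R * ucirc t))) has_integral
       2 * integral {0..1} (\<lambda>t. cmod (h (of_real R * ucirc t)))) {0..1}"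
    by (intro has_integral_mult_right integrable_integral)
  have "cmod (integral {0..1} (\<lambda>t. h (of_real R * ucirc t) / (of_real R * ucirc t - u) * (R * ucirc t)))
    \<le> integral {0..1} (\<lambda>t. 2 * cmod (h (of_real R * ucirc t)))"
  proof (rule integral_norm_bound_integral)
    show "cmod (h (of_real R * ucirc t) / (of_real R * ucirc t - u) * (R * ucirc t))
       \<le> 2 * cmod (h (of_real R * ucirc t))" for t
    proof -
      have "R / 2 \<le> cmod (of_real R * ucirc t - u)"
        using norm_triangle_ineq2[of "of_real R * ucirc t" u] u R by (simp add: norm_mult)
      then have "R / cmod (of_real R * ucirc t - u) \<le> 2" using R by (simp add: divide_simps)
      from mult_left_mono[OF this norm_ge_zero[of "h (of_real R * ucirc t)"]]
      show ?thesis using R by (simp add: norm_mult norm_divide mult_ac)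
    qed
  qed (use I J in \<open>blast+\<close>)
  then show ?thesis using I J by (simp add: integral_unique)
qed

text \<open>Real counterpart of \<open>cmean\<close>, to which parameter integrals, norm bounds and
  Cauchy's formula apply directly; \<open>cmean_eq_circ_mean\<close> translates.\<close>

definition circ_mean :: "(complex \<Rightarrow> real) \<Rightarrow> complex \<Rightarrow> real" where
  "circ_mean G z = integral {0..1} (\<lambda>t. G (z * ucirc t))"

lemma cmean_eq_circ_mean:
  assumes G: "continuous_on (ball 0 R) G" "\<And>z. z \<in> ball 0 R \<Longrightarrow> 0 \<le> G z" and z: "cmod z < R"
  shows "cmean (\<lambda>z. ennreal (G z) * indicator (ball 0 R) z) z = ennreal (circ_mean G z)"
proof -
  have "((\<lambda>t. G (z * ucirc t)) has_integral circ_mean G z) {0..1}"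
    unfolding circ_mean_def
    by (intro integrable_integral integrable_continuous_real continuous_on_circle[OF G(1) z])
  then have "(\<integral>\<^sup>+t. ennreal (G (z * ucirc t)) * indicator {0..1} t \<partial>lborel) = ennreal (circ_mean G z)"
    by (intro nn_integral_has_integral_lebesgue' G(2)) (use z in \<open>auto simp: norm_mult\<close>)
  then show ?thesis using z by (simp add: cmean_def norm_mult)
qed

lemma borel_measurable_indicator_ball:
  assumes "continuous_on (ball 0 R) (G :: complex \<Rightarrow> real)"
  shows "(\<lambda>z. ennreal (G z) * indicator (ball 0 R) z) \<in> borel_measurable borel"
proof -
  have "(\<lambda>z. indicator (ball 0 R) z *\<^sub>R G z) \<in> borel_measurable borel"
    by (rule borel_measurable_continuous_on_indicator[OF _ assms]) auto
  then have "(\<lambda>z. ennreal (indicator (ball 0 R) z *\<^sub>R G z)) \<in> borel_measurable borel" by simp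
  moreover have "(\<lambda>z. ennreal (G z) * indicator (ball 0 R) z) = (\<lambda>z. ennreal (indicator (ball 0 R) z *\<^sub>R G z))"
    by (auto simp: fun_eq_iff indicator_def)
  ultimately show ?thesis by simp
qed

lemma circ_mean_cmod:
  assumes G: "continuous_on (ball 0 R) G" "\<And>z. z \<in> ball 0 R \<Longrightarrow> 0 \<le> G z" and z: "cmod z < R"
  shows "circ_mean G z = circ_mean G (of_real (cmod z))"
proof -
  let ?F = "\<lambda>z. ennreal (G z) * indicator (ball 0 R) z"
  have "0 \<le> circ_mean G w" if "cmod w < R" for w
    unfolding circ_mean_def using that
    by (intro integral_nonneg integrable_continuous_real continuous_on_circle[OF G(1)] G(2)) (auto simp: norm_mult)
  moreover have "ennreal (circ_mean G z) = ennreal (circ_mean G (of_real (cmod z)))"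
    using cmean_cmod[OF borel_measurable_indicator_ball[OF G(1)], of z]
    by (subst (asm) (1 2) cmean_eq_circ_mean[OF G]) (use z in auto)
  ultimately show ?thesis using z by (metis ennreal_inj norm_of_real abs_norm_cancel)
qed

lemma continuous_on_circ_mean:
  assumes G: "continuous_on (ball 0 R) G"
  shows "continuous_on (ball 0 R) (circ_mean G)"
proof -
  have "continuous_on (ball 0 R) (\<lambda>z. integral (cbox 0 1) (\<lambda>t. G (z * ucirc t)))"
  proof (rule integral_continuous_on_param)
    show "continuous_on (ball 0 R \<times> cbox 0 1) (\<lambda>(z, t). G (z * ucirc t))"
    proof -
      have "continuous_on (ball 0 R \<times> cbox 0 1) (\<lambda>x :: complex \<times> real. fst x * ucirc (snd x))"
        by (intro continuous_intros)
      then have "continuous_on (ball 0 R \<times> cbox 0 1) (\<lambda>x :: complex \<times> real. G (fst x * ucirc (snd x)))"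
        by (rule continuous_on_compose2[OF G]) (auto simp: norm_mult)
      then show ?thesis unfolding split_beta .
    qed
  qed
  then show ?thesis unfolding circ_mean_def by simp
qed

text \<open>Weighting \<open>h (z * ucirc t)\<close> by the conjugate phase of \<open>h (a * ucirc t)\<close> and averaging over \<open>t\<close>
  gives a function holomorphic in \<open>z\<close> whose value at \<open>a\<close> is the mean of \<open>\<bar>h\<bar>\<close>.\<close>
lemma circ_mean_zero_free_mono:
  assumes h: "h holomorphic_on ball 0 R'" and nz: "\<And>z. z \<in> ball 0 R' \<Longrightarrow> h z \<noteq> 0"
    and a: "cmod a \<le> R" and R: "0 < R" "R < R'"
  shows "circ_mean (\<lambda>z. cmod (h z)) a \<le> circ_mean (\<lambda>z. cmod (h z)) (of_real R)"
proof -
  have cont: "continuous_on (ball 0 R') h" using h by (rule holomorphic_on_imp_continuous_on)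
  have contn: "continuous_on (ball 0 R') (\<lambda>z. cmod (h z))" by (intro continuous_intros cont)
  have contd: "continuous_on (ball 0 R') (deriv h)"
    using h by (intro holomorphic_on_imp_continuous_on holomorphic_deriv) auto
  define \<sigma> where "\<sigma> t = cnj (h (a * ucirc t)) / of_real (cmod (h (a * ucirc t)))" for t
  \<comment> \<open>Here the absence of zeros is used: it makes the phase \<open>\<sigma>\<close>
    continuous along the circle.\<close>
  have az: "h (a * ucirc t) \<noteq> 0" for t using nz[of "a * ucirc t"] a R by (simp add: norm_mult)
  have cont\<sigma>: "continuous_on {0..1} \<sigma>"
    unfolding \<sigma>_def using az a R by (intro continuous_intros continuous_on_circle[OF cont]) auto
  have norm\<sigma>: "cmod (\<sigma> t) = 1" for t using az[of t] by (simp add: \<sigma>_def norm_divide)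
  define H where "H z = integral (cbox 0 1) (\<lambda>t. \<sigma> t * h (z * ucirc t))" for z
  have int: "(\<lambda>t. \<sigma> t * h (z * ucirc t)) integrable_on {0..1}" if "cmod z < R'" for z
    by (intro integrable_continuous_real continuous_intros cont\<sigma> continuous_on_circle[OF cont that])
  have intn: "(\<lambda>t. cmod (h (z * ucirc t))) integrable_on {0..1}" if "cmod z < R'" for z
    by (intro integrable_continuous_real continuous_on_circle[OF contn that])
  have H: "H holomorphic_on ball 0 R'"
    unfolding H_def
  proof (rule leibniz_rule_holomorphic)
    fix z :: complex and t :: real assume z: "z \<in> ball 0 R'"
    have "h field_differentiable at (z * ucirc t)"
      using h z by (intro holomorphic_on_imp_differentiable_at[of _ "ball 0 R'"]) (auto simp: norm_mult)
    then have d: "(h has_field_derivative deriv h (z * ucirc t)) (at (z * ucirc t))"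
      by (simp add: field_differentiable_derivI)
    have "((\<lambda>z. h (z * ucirc t)) has_field_derivative deriv h (z * ucirc t) * ucirc t) (at z)"
      by (rule DERIV_chain2[where g="\<lambda>z. z * ucirc t", OF d]) (auto intro!: derivative_eq_intros)
    from has_field_derivative_at_within[OF DERIV_cmult[OF this]]
    show "((\<lambda>z. \<sigma> t * h (z * ucirc t)) has_field_derivative \<sigma> t * (deriv h (z * ucirc t) * ucirc t))
        (at z within ball 0 R')" .
  next
    show "continuous_on (ball 0 R' \<times> cbox 0 1) (\<lambda>(z, t). \<sigma> t * (deriv h (z * ucirc t) * ucirc t))"
    proof -
      have "continuous_on (ball 0 R' \<times> cbox 0 1) (\<lambda>x :: complex \<times> real. \<sigma> (snd x))"
        by (rule continuous_on_compose2[OF cont\<sigma>]) (auto intro: continuous_intros)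
      moreover have "continuous_on (ball 0 R' \<times> cbox 0 1) (\<lambda>x :: complex \<times> real. deriv h (fst x * ucirc (snd x)))"
        by (rule continuous_on_compose2[OF contd]) (auto intro!: continuous_intros simp: norm_mult)
      ultimately show ?thesis
        unfolding split_beta by (intro continuous_on_mult continuous_ucirc continuous_on_snd continuous_on_id)
    qed
  qed (use int in auto)
  have "cmod (H a) \<le> circ_mean (\<lambda>z. cmod (h z)) (of_real R)"
  proof (rule maximum_modulus_frontier[of H "cball 0 R"])
    show "H holomorphic_on interior (cball 0 R)"
      using H by (rule holomorphic_on_subset) (use R in auto)
    show "continuous_on (closure (cball 0 R)) H"
      using holomorphic_on_imp_continuous_on[OF H]
      by (rule continuous_on_subset) (use R in auto)
    fix z :: complex assume "z \<in> frontier (cball 0 R)"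
    then have z: "cmod z = R" by simp
    \<comment> \<open>The unimodular weight disappears in the norm bound, and every base point on
      the circle yields the same mean.\<close>
    have "cmod (H z) \<le> integral {0..1} (\<lambda>t. cmod (h (z * ucirc t)))"
      unfolding H_def cbox_interval
      by (rule integral_norm_bound_integral) (use z R int intn in \<open>auto simp: norm_mult norm\<sigma>\<close>)
    also have "\<dots> = circ_mean (\<lambda>z. cmod (h z)) z" by (simp add: circ_mean_def)
    also have "\<dots> = circ_mean (\<lambda>z. cmod (h z)) (of_real R)"
      using circ_mean_cmod[OF contn, of z] z R by simp
    finally show "cmod (H z) \<le> circ_mean (\<lambda>z. cmod (h z)) (of_real R)" .
  qed (use a in auto)
  moreover have "H a = of_real (circ_mean (\<lambda>z. cmod (h z)) a)"
  proof -
    have "\<sigma> t * h (a * ucirc t) = of_real (cmod (h (a * ucirc t)))" for t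
    proof -
      have "cnj (h (a * ucirc t)) * h (a * ucirc t) = of_real (cmod (h (a * ucirc t))) * of_real (cmod (h (a * ucirc t)))"
        by (metis complex_norm_square mult.commute of_real_power power2_eq_square)
      then show ?thesis using az[of t] by (simp add: \<sigma>_def)
    qed
    then have "((\<lambda>t. \<sigma> t * h (a * ucirc t)) has_integral of_real (circ_mean (\<lambda>z. cmod (h z)) a)) {0..1}"
      unfolding circ_mean_def using intn[of a] a R
      by (simp add: has_integral_of_real integrable_integral)
    then show ?thesis unfolding H_def by (simp add: integral_unique)
  qed
  ultimately show ?thesis by simp
qed

text \<open>Finitely many zeros in a compact disc occupy finitely many radii, while an interval
  contains infinitely many. \<open>R1\<close> stays below \<open>R'\<close> because zeros may
  accumulate at the outer boundary.\<close>

lemma sphere_avoiding_zeros: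
  assumes f: "f holomorphic_on ball 0 R'" and R: "0 < R" "R < R'" and e: "0 < e" and ne: "\<exists>z\<in>ball 0 R'. f z \<noteq> 0"
  obtains s where "R < s" "s < R + e" "s < R'" "\<And>z. cmod z = s \<Longrightarrow> f z \<noteq> 0"
proof -
  define R1 where "R1 = min (R + e) ((R + R') / 2)"
  have R1: "R < R1" "R1 \<le> R + e" "R1 < R'" using R e by (auto simp: R1_def min_def)
  have fin: "finite {z \<in> cball 0 R1. f z = 0}"
  proof (cases "f constant_on ball 0 R'")
    case True
    then obtain c where c: "\<And>z. z \<in> ball 0 R' \<Longrightarrow> f z = c" unfolding constant_on_def by blast
    then have "{z \<in> cball 0 R1. f z = 0} = {}" using ne R1 by fastforce
    then show ?thesis by (metis finite.emptyI)
  next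
    case False
    show ?thesis
      by (rule holomorphic_compact_finite_zeros[OF f open_ball connected_ball compact_cball _ False]) (use R1 in auto)
  qed
  have "infinite {R<..<R1}" using R1 by (simp add: infinite_Ioo)
  then have "\<not> {R<..<R1} \<subseteq> cmod ` {z \<in> cball 0 R1. f z = 0}"
    using finite_surj[OF fin] by blast
  then obtain s where s: "R < s" "s < R1" "s \<notin> cmod ` {z \<in> cball 0 R1. f z = 0}"
    unfolding subset_eq by (metis greaterThanLessThan_iff)
  show thesis using s R1 by (intro that[of s]) auto
qed

text \<open>The two mean value inequalities for \<open>\<bar>f\<bar>\<^sup>p\<close> are clear on circles free of zeros; the other
  circles are limits of such ones.\<close>
lemma le_on_zero_free_spheres_imp_le:
  assumes f: "f holomorphic_on ball 0 R'" and R: "0 < R" "R < R'" and ne: "\<exists>z\<in>ball 0 R'. f z \<noteq> 0"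
    and Q: "continuous_on (ball 0 R') (Q :: complex \<Rightarrow> real)"
    and le: "\<And>s. R < s \<Longrightarrow> s < R' \<Longrightarrow> (\<And>z. cmod z = s \<Longrightarrow> f z \<noteq> 0) \<Longrightarrow> c \<le> Q (of_real s)"
  shows "c \<le> Q (of_real R)"
proof (rule ccontr)
  assume "\<not> c \<le> Q (of_real R)"
  then have "0 < c - Q (of_real R)" by simp
  moreover have "complex_of_real R \<in> ball 0 R'" using R by simp
  ultimately obtain d where d: "d > 0" "\<And>z. z \<in> ball 0 R' \<Longrightarrow> dist z (of_real R) < d \<Longrightarrow> dist (Q z) (Q (of_real R)) < c - Q (of_real R)"
    using Q unfolding continuous_on_iff by metis
  obtain s where s: "R < s" "s < R + d" "s < R'" "\<And>z. cmod z = s \<Longrightarrow> f z \<noteq> 0"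
    using sphere_avoiding_zeros[OF f R d(1) ne] by metis
  have "dist (complex_of_real s) (of_real R) < d"
    using s by (simp add: dist_norm flip: of_real_diff)
  then have "dist (Q (of_real s)) (Q (of_real R)) < c - Q (of_real R)" using s R by (intro d(2)) auto
  then show False using le[OF s(1,3,4)] by (auto simp: dist_real_def)
qed

section \<open>Mean value inequalities for powers of the modulus\<close>

lemma continuous_on_cmod_powr:
  assumes "f holomorphic_on S" "0 < p"
  shows "continuous_on S (\<lambda>z. cmod (f z) powr p)"
  using assms by (intro continuous_on_powr' continuous_intros holomorphic_on_imp_continuous_on) auto

text \<open>No regularity of \<open>f\<close> is assumed: the integral of a non-integrable function
  is 0 by convention.\<close>

lemma circ_mean_powr_nonneg: "0 \<le> circ_mean (\<lambda>z. cmod (f z) powr p) a"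
  unfolding circ_mean_def by (cases "(\<lambda>t. cmod (f (a * ucirc t)) powr p) integrable_on {0..1}")
    (auto intro: integral_nonneg simp: not_integrable_integral)

lemma circ_mean_mono_le:
  assumes "\<And>t. F (a * ucirc t) \<le> G (a * ucirc t)"
    "continuous_on (ball 0 R) F" "continuous_on (ball 0 R') G" "cmod a < R" "cmod a < R'"
  shows "circ_mean F a \<le> circ_mean G a"
  unfolding circ_mean_def
proof (rule integral_le)
  show "(\<lambda>t. F (a * ucirc t)) integrable_on {0..1}"
    by (rule integrable_continuous_real[OF continuous_on_circle[OF assms(2,4)]])
  show "(\<lambda>t. G (a * ucirc t)) integrable_on {0..1}"
    by (rule integrable_continuous_real[OF continuous_on_circle[OF assms(3,5)]])
qed (rule assms(1))

lemma circ_mean_powr_mono: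
  assumes f: "f holomorphic_on ball 0 R'" and p: "0 < p" and a: "cmod a \<le> R" and R: "R < R'"
  shows "circ_mean (\<lambda>z. cmod (f z) powr p) a \<le> circ_mean (\<lambda>z. cmod (f z) powr p) (of_real R)"
\<comment> \<open>\<open>R = 0\<close> forces \<open>a = 0\<close>, and for the zero function no
  circle is free of zeros; both are settled directly.\<close>
proof (cases "R = 0 \<or> (\<forall>z\<in>ball 0 R'. f z = 0)")
  case True
  then show ?thesis
  proof
    assume "\<forall>z\<in>ball 0 R'. f z = 0"
    then have "cmod (f (a * ucirc t)) powr p = 0" for t using a R by (simp add: norm_mult)
    then have "circ_mean (\<lambda>z. cmod (f z) powr p) a = 0" unfolding circ_mean_def by simp
    then show ?thesis by (simp add: circ_mean_powr_nonneg)
  qed (use a in simp)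
next
  case False
  then have R0: "0 < R" using a norm_ge_zero[of a] by linarith
  note cp = continuous_on_cmod_powr[OF f p]
  show ?thesis
  proof (rule le_on_zero_free_spheres_imp_le[OF f R0 R _ continuous_on_circ_mean[OF cp]])
    fix s assume s: "R < s" "s < R'" and nz: "\<And>z. cmod z = s \<Longrightarrow> f z \<noteq> 0"
    obtain h R'' where h: "s < R''" "h holomorphic_on ball 0 R''" "\<And>z. z \<in> ball 0 R'' \<Longrightarrow> h z \<noteq> 0"
      "\<And>z. cmod z \<le> s \<Longrightarrow> cmod (f z) powr p \<le> cmod (h z)"
      "\<And>z. cmod z = s \<Longrightarrow> cmod (f z) powr p = cmod (h z)"
      using zero_free_power_majorant[OF f less_trans[OF R0 s(1)] s(2) nz p] by metis
    have "circ_mean (\<lambda>z. cmod (f z) powr p) a \<le> circ_mean (\<lambda>z. cmod (h z)) a"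
    proof (rule circ_mean_mono_le[OF _ cp])
      show "continuous_on (ball 0 R'') (\<lambda>z. cmod (h z))"
        by (intro continuous_on_norm holomorphic_on_imp_continuous_on h(2))
      show "cmod (f (a * ucirc t)) powr p \<le> cmod (h (a * ucirc t))" for t
        by (rule h(4)) (use a s in \<open>simp add: norm_mult\<close>)
    qed (use a R s h(1) in auto)
    also have "\<dots> \<le> circ_mean (\<lambda>z. cmod (h z)) (of_real s)"
      using a s h R0 by (intro circ_mean_zero_free_mono[OF h(2,3)]) auto
    also have "\<dots> = circ_mean (\<lambda>z. cmod (f z) powr p) (of_real s)"
      unfolding circ_mean_def using s R0 by (intro integral_cong) (simp add: h(5) norm_mult)
    finally show "circ_mean (\<lambda>z. cmod (f z) powr p) a \<le> circ_mean (\<lambda>z. cmod (f z) powr p) (of_real s)" .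
  qed (use False in auto)
qed

lemma powr_half_disc_bound:
  assumes f: "f holomorphic_on ball 0 R'" and p: "0 < p" and R: "0 < R" "R < R'" and u: "cmod u \<le> R / 2"
  shows "cmod (f u) powr p \<le> 2 * circ_mean (\<lambda>z. cmod (f z) powr p) (of_real R)"
proof (cases "\<forall>z\<in>ball 0 R'. f z = 0")
  case True
  then show ?thesis using u R by (simp add: circ_mean_powr_nonneg)
next
  case False
  note cp = continuous_on_cmod_powr[OF f p]
  \<comment> \<open>The 2 goes to the left because the limiting argument compares a constant with
    the continuous mean itself.\<close>
  have "cmod (f u) powr p / 2 \<le> circ_mean (\<lambda>z. cmod (f z) powr p) (of_real R)"
  proof (rule le_on_zero_free_spheres_imp_le[OF f R _ continuous_on_circ_mean[OF cp]])
    fix s assume s: "R < s" "s < R'" and nz: "\<And>z. cmod z = s \<Longrightarrow> f z \<noteq> 0"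
    obtain h R'' where h: "s < R''" "h holomorphic_on ball 0 R''" "\<And>z. z \<in> ball 0 R'' \<Longrightarrow> h z \<noteq> 0"
      "\<And>z. cmod z \<le> s \<Longrightarrow> cmod (f z) powr p \<le> cmod (h z)"
      "\<And>z. cmod z = s \<Longrightarrow> cmod (f z) powr p = cmod (h z)"
      using zero_free_power_majorant[OF f less_trans[OF R(1) s(1)] s(2) nz p] by metis
    have "cmod (f u) powr p \<le> cmod (h u)" using u R s by (intro h(4)) auto
    also have "\<dots> \<le> 2 * integral {0..1} (\<lambda>t. cmod (h (of_real s * ucirc t)))"
      using s R u h(1) by (intro holomorphic_half_disc_bound[OF h(2)]) auto
    also have "integral {0..1} (\<lambda>t. cmod (h (of_real s * ucirc t))) = circ_mean (\<lambda>z. cmod (f z) powr p) (of_real s)"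
      unfolding circ_mean_def using s R by (intro integral_cong) (simp add: h(5) norm_mult)
    finally show "cmod (f u) powr p / 2 \<le> circ_mean (\<lambda>z. cmod (f z) powr p) (of_real s)" by simp
  qed (use False in auto)
  then show ?thesis by simp
qed

subsection \<open>Radial weights and tails\<close>

text \<open>The image under \<open>cmod\<close> of the weighted normalised area on the disc: the
  Jacobian \<open>2 * pi * r\<close> divided by \<open>pi\<close>.\<close>

definition radial_measure :: "(real \<Rightarrow> real) \<Rightarrow> real measure" where
  "radial_measure v = density lborel (\<lambda>r. ennreal (2 * r * v r) * indicator {0..<1} r)"

lemma sets_radial_measure[measurable_cong, simp]: "sets (radial_measure v) = sets borel"
  by (simp add: radial_measure_def)

lemma space_radial_measure[simp]: "space (radial_measure v) = UNIV"
  by (simp add: radial_measure_def)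

lemma nn_integral_area_radial:
  assumes [measurable]: "F \<in> borel_measurable borel" "v \<in> borel_measurable borel"
  shows "(\<integral>\<^sup>+z. F z * ennreal (v (cmod z)) * indicator (ball 0 1) z \<partial>area_measure) =
    (\<integral>\<^sup>+r. cmean F (of_real r) \<partial>radial_measure v)"
proof -
  define g where "g r = ennreal (v r) * indicator {..<1} r" for r
  have [measurable]: "g \<in> borel_measurable borel" unfolding g_def by simp
  have g: "F z * ennreal (v (cmod z)) * indicator (ball 0 1) z = F z * g (cmod z)" for z
    by (simp add: g_def indicator_def)
  have "(\<integral>\<^sup>+z. F z * g (cmod z) \<partial>area_measure) = ennreal (1 / pi) * (\<integral>\<^sup>+z. F z * g (cmod z) \<partial>lborel)"
    unfolding area_measure_def
    by (subst nn_integral_scale_measure) (auto simp: nn_integral_completion intro!: measurable_completion)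
  also have "\<dots> = ennreal (1 / pi) *
      (\<integral>\<^sup>+r. ennreal (2 * pi * r) * indicator {0<..} r * (cmean F (of_real r) * g r) \<partial>lborel)"
    by (simp add: nn_integral_polar)
  also have "\<dots> = (\<integral>\<^sup>+r. ennreal (1 / pi) *
      (ennreal (2 * pi * r) * indicator {0<..} r * (cmean F (of_real r) * g r)) \<partial>lborel)"
    by (rule nn_integral_cmult[symmetric]) measurable
  also have "\<dots> = (\<integral>\<^sup>+r. ennreal (2 * r * v r) * indicator {0..<1} r * cmean F (of_real r) \<partial>lborel)"
  proof (rule nn_integral_cong)
    fix r :: real
    show "ennreal (1 / pi) * (ennreal (2 * pi * r) * indicator {0<..} r * (cmean F (of_real r) * g r)) =
        ennreal (2 * r * v r) * indicator {0..<1} r * cmean F (of_real r)"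
    proof (cases "0 < r \<and> r < 1")
      case True
      have "ennreal (1 / pi) * ennreal (2 * pi * r) = ennreal (2 * r)"
        using True by (subst ennreal_mult''[symmetric]) auto
      moreover have "ennreal (2 * r * v r) = ennreal (2 * r) * ennreal (v r)"
        using True by (intro ennreal_mult') auto
      moreover have "ennreal (1 / pi) * (ennreal (2 * pi * r) * (cmean F (of_real r) * ennreal (v r))) =
          (ennreal (1 / pi) * ennreal (2 * pi * r)) * ennreal (v r) * cmean F (of_real r)"
        by (simp only: mult_ac)
      ultimately show ?thesis using True by (simp add: g_def)
    next
      case False
      then show ?thesis by (cases "r = 0") (auto simp: indicator_def g_def)
    qed
  qed
  also have "\<dots> = (\<integral>\<^sup>+r. cmean F (of_real r) \<partial>radial_measure v)"
    unfolding radial_measure_def by (subst nn_integral_density) auto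
  finally show ?thesis by (simp add: g)
qed

text \<open>The image of area under \<open>cmod\<close> has a density, so an exceptional null set of
  radii lifts to a null set in the plane.\<close>

lemma AE_lborel_cmod:
  assumes "AE r in lborel. P r"
  shows "AE z in lborel. P (cmod z)"
proof -
  obtain N where N: "{r. \<not> P r} \<subseteq> N" "N \<in> sets borel" "emeasure lborel N = 0"
    using assms by (auto elim!: AE_E)
  have "AE r in lborel. r \<notin> N" using N by (intro AE_not_in) auto
  have "emeasure lborel (cmod -` N) = (\<integral>\<^sup>+z. indicator N (cmod z) \<partial>lborel)"
  proof -
    have "cmod -` N \<in> sets lborel" using N(2) measurable_sets_borel[of cmod borel N] by simp
    then have "emeasure lborel (cmod -` N) = (\<integral>\<^sup>+z. indicator (cmod -` N) z \<partial>lborel)"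
      by (rule nn_integral_indicator[symmetric])
    also have "\<dots> = (\<integral>\<^sup>+z. indicator N (cmod z) \<partial>lborel)"
      by (rule nn_integral_cong) (auto simp: indicator_def)
    finally show ?thesis .
  qed
  also have "\<dots> = (\<integral>\<^sup>+r. ennreal (2 * pi * r) * indicator {0<..} r * indicator N r \<partial>lborel)"
    using N by (intro nn_integral_radial) auto
  also have "\<dots> = (\<integral>\<^sup>+r. 0 \<partial>(lborel :: real measure))"
    using \<open>AE r in lborel. r \<notin> N\<close> by (intro nn_integral_cong_AE) (auto elim!: eventually_mono)
  finally have "emeasure lborel (cmod -` N) = 0" by simp
  moreover have "cmod -` N \<in> sets lborel" using N(2) measurable_sets_borel[of cmod borel N] by simp
  ultimately have "AE z in lborel. z \<notin> cmod -` N" by (intro AE_not_in) auto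
  then show ?thesis using N(1) by (auto elim!: eventually_mono)
qed

text \<open>A weight is only Lebesgue measurable, whereas polar integration and Tonelli above are
  stated for Borel functions. An almost everywhere equal Borel profile changes neither the area
  integrals nor the tails.\<close>

lemma radial_weight_borel_version:
  assumes "radial_weight w"
  shows "\<exists>v\<in>borel_measurable borel. (\<forall>r. 0 \<le> v r) \<and>
    (\<forall>F\<in>borel_measurable borel. (\<integral>\<^sup>+z\<in>ball 0 1. F z * ennreal (w (cmod z)) \<partial>area_measure) =
       (\<integral>\<^sup>+r. cmean F (of_real r) \<partial>radial_measure v)) \<and>
    (\<forall>a\<ge>0. ennreal (weight_tail w a) = (\<integral>\<^sup>+s\<in>{a..<1}. ennreal (v s) \<partial>lborel))"
proof -
  have w0: "0 \<le> w r" if "0 \<le> r" "r < 1" for r using assms that by (auto simp: radial_weight_def)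
  have si: "set_integrable lebesgue {0..<1} w" using assms by (simp add: radial_weight_def)
  then have "(\<lambda>r. indicator {0..<1} r *\<^sub>R w r) \<in> borel_measurable lebesgue"
    unfolding set_integrable_def by (rule borel_measurable_integrable)
  from completion_ex_borel_measurable_real[OF this]
  obtain u where u: "u \<in> borel_measurable lborel" "AE r in lborel. indicator {0..<1} r *\<^sub>R w r = u r" by blast
  \<comment> \<open>Truncation gives nonnegativity everywhere and changes nothing almost everywhere
    on \<open>{0..<1}\<close>, where \<open>w\<close> is nonnegative.\<close>
  define v where "v r = max 0 (u r)" for r
  have [measurable]: "v \<in> borel_measurable borel" using u(1) unfolding v_def by simp
  have eq: "AE r in lborel. 0 \<le> r \<and> r < 1 \<longrightarrow> w r = v r"
    using u(2)
  proof eventually_elim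
    case (elim r)
    then show ?case using w0[of r] by (auto simp: v_def indicator_def)
  qed
  show ?thesis
  proof (intro bexI[of _ v] conjI ballI allI impI)
    show "v \<in> borel_measurable borel" by simp
    show "0 \<le> v r" for r by (simp add: v_def)
  next
    fix F :: "complex \<Rightarrow> ennreal" assume [measurable]: "F \<in> borel_measurable borel"
    have "AE z in lebesgue. cmod z < 1 \<longrightarrow> w (cmod z) = v (cmod z)"
      using AE_lborel_cmod[OF eq] by (intro AE_completion) auto
    then have ae: "AE z in area_measure. cmod z < 1 \<longrightarrow> w (cmod z) = v (cmod z)"
      unfolding area_measure_def eventually_ae_filter null_sets_def
      by (auto simp: space_scale_measure)
    have "(\<integral>\<^sup>+z\<in>ball 0 1. F z * ennreal (w (cmod z)) \<partial>area_measure)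
       = (\<integral>\<^sup>+z\<in>ball 0 1. F z * ennreal (v (cmod z)) \<partial>area_measure)"
      using ae by (intro nn_integral_cong_AE) (auto elim!: eventually_mono simp: indicator_def)
    also have "\<dots> = (\<integral>\<^sup>+r. cmean F (of_real r) \<partial>radial_measure v)"
      by (rule nn_integral_area_radial) auto
    finally show "(\<integral>\<^sup>+z\<in>ball 0 1. F z * ennreal (w (cmod z)) \<partial>area_measure)
       = (\<integral>\<^sup>+r. cmean F (of_real r) \<partial>radial_measure v)" .
  next
    fix a :: real assume a: "0 \<le> a"
    have "set_integrable lebesgue {a..<1} w"
      using si by (rule set_integrable_subset) (use a in auto)
    then have "ennreal (weight_tail w a) = (\<integral>\<^sup>+s. ennreal (indicator {a..<1} s *\<^sub>R w s) \<partial>lebesgue)"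
      unfolding weight_tail_def set_lebesgue_integral_def set_integrable_def
      by (intro nn_integral_eq_integral[symmetric]) (auto simp: indicator_def w0 a intro!: AE_I2 dest: order_trans[OF a])
    also have "\<dots> = (\<integral>\<^sup>+s. ennreal (indicator {a..<1} s *\<^sub>R w s) \<partial>lborel)"
      by (rule nn_integral_completion)
    also have "\<dots> = (\<integral>\<^sup>+s\<in>{a..<1}. ennreal (v s) \<partial>lborel)"
      using eq a by (intro nn_integral_cong_AE) (auto elim!: eventually_mono simp: indicator_def)
    finally show "ennreal (weight_tail w a) = (\<integral>\<^sup>+s\<in>{a..<1}. ennreal (v s) \<partial>lborel)" .
  qed
qed

text \<open>\<open>\<phi> x\<close> is the length of the set of \<open>t \<ge> 0\<close> below it,
  also when it is infinite; Tonelli then exchanges \<open>x\<close> and \<open>t\<close>.\<close>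

lemma nn_integral_layer_cake:
  assumes "sigma_finite_measure M" and [measurable]: "\<phi> \<in> borel_measurable M"
  shows "(\<integral>\<^sup>+x. \<phi> x \<partial>M) = (\<integral>\<^sup>+t\<in>{0..}. emeasure M {x \<in> space M. ennreal t < \<phi> x} \<partial>lborel)"
proof -
  interpret M: sigma_finite_measure M by fact
  interpret P: pair_sigma_finite M "lborel :: real measure" ..
  have lev: "\<phi> x = (\<integral>\<^sup>+t. indicator {t. 0 \<le> t \<and> ennreal t < \<phi> x} t \<partial>lborel)" for x
  proof (cases "\<phi> x")
    case (real c)
    then have "{t. 0 \<le> t \<and> ennreal t < \<phi> x} = {0..<c}" by (auto simp: ennreal_less_iff)
    then show ?thesis using real by simp
  next
    case top
    then have "{t. 0 \<le> t \<and> ennreal t < \<phi> x} = {0..}" by auto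
    moreover have "emeasure lborel {0::real..} = top"
    proof (rule ccontr)
      assume "emeasure lborel {0::real..} \<noteq> top"
      then obtain c where c: "0 \<le> c" "emeasure lborel {0::real..} = ennreal c"
        by (cases "emeasure lborel {0::real..}") auto
      have "emeasure lborel {0..c + 1} \<le> emeasure lborel {0::real..}" by (rule emeasure_mono) auto
      then show False using c by simp
    qed
    ultimately show ?thesis using top by simp
  qed
  have "(\<integral>\<^sup>+x. \<phi> x \<partial>M) = (\<integral>\<^sup>+x. (\<integral>\<^sup>+t. indicator {t. 0 \<le> t \<and> ennreal t < \<phi> x} t \<partial>lborel) \<partial>M)"
    using lev by (rule nn_integral_cong)
  also have "\<dots> = (\<integral>\<^sup>+t. (\<integral>\<^sup>+x. indicator {t. 0 \<le> t \<and> ennreal t < \<phi> x} t \<partial>M) \<partial>lborel)"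
    by (rule P.Fubini'[symmetric]) measurable
  also have "\<dots> = (\<integral>\<^sup>+t\<in>{0..}. emeasure M {x \<in> space M. ennreal t < \<phi> x} \<partial>lborel)"
  proof (rule nn_integral_cong)
    fix t :: real
    have "(\<integral>\<^sup>+x. indicator {t. 0 \<le> t \<and> ennreal t < \<phi> x} t \<partial>M)
       = (\<integral>\<^sup>+x. indicator {0..} t * indicator {x \<in> space M. ennreal t < \<phi> x} x \<partial>M)"
      by (rule nn_integral_cong) (auto simp: indicator_def)
    also have "\<dots> = indicator {0..} t * emeasure M {x \<in> space M. ennreal t < \<phi> x}"
      by (rule nn_integral_cmult_indicator) measurable
    finally show "(\<integral>\<^sup>+x. indicator {t. 0 \<le> t \<and> ennreal t < \<phi> x} t \<partial>M)
       = emeasure M {x \<in> space M. ennreal t < \<phi> x} * indicator {0..} t" by (simp add: mult.commute)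
  qed
  finally show ?thesis .
qed

text \<open>By the layer cake formula it suffices to compare superlevel sets, which are intervals
  reaching up to 1.\<close>
lemma nn_integral_midpoint_le:
  fixes \<phi> :: "real \<Rightarrow> ennreal"
  assumes "sigma_finite_measure M" and sets[measurable_cong]: "sets M = sets borel"
    and [measurable]: "\<phi> \<in> borel_measurable borel"
    and mono: "\<And>r s. 0 \<le> r \<Longrightarrow> r \<le> s \<Longrightarrow> s < 1 \<Longrightarrow> \<phi> r \<le> \<phi> s"
    and atom: "\<And>a. emeasure M {a} = 0"
    and tail: "\<And>a. 0 \<le> a \<Longrightarrow> a < 1 \<Longrightarrow> emeasure M {a..<1} \<le> C * emeasure M {(1 + a) / 2..<1}"
  shows "(\<integral>\<^sup>+r\<in>{0..<1}. \<phi> ((1 + r) / 2) \<partial>M) \<le> C * (\<integral>\<^sup>+r\<in>{0..<1}. \<phi> r \<partial>M)"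
proof -
  have sp: "space M = UNIV" using sets_eq_imp_space_eq[OF sets] by simp
  have level: "emeasure M {r. ennreal t < \<phi> ((1 + r) / 2) * indicator {0..<1} r}
      \<le> C * emeasure M {r. ennreal t < \<phi> r * indicator {0..<1} r}" (is "emeasure M ?B \<le> C * emeasure M ?A") for t
  proof -
    have B: "?B = {r. 0 \<le> r \<and> r < 1 \<and> ennreal t < \<phi> ((1 + r) / 2)}" by (auto simp: indicator_def split: if_splits)
    have A: "?A = {r. 0 \<le> r \<and> r < 1 \<and> ennreal t < \<phi> r}" by (auto simp: indicator_def split: if_splits)
    have mem: "(1 + r) / 2 \<in> ?A" if "r \<in> ?B" for r using that unfolding A B by auto
    have [measurable]: "?A \<in> sets M" using measurable_sets[of "\<lambda>r. \<phi> r * indicator {0..<1} r" M borel "{ennreal t<..}"]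
      by (simp add: sp vimage_def sets)
    show ?thesis
    proof (cases "?A = {}")
      case True
      then have "?B = {}" using mem by blast
      then show ?thesis by simp
    next
      case False
      define a where "a = Inf ?A"
      have bdd: "bdd_below ?A" unfolding A by (rule bdd_belowI[of _ 0]) auto
      have a_le: "a \<le> r" if "r \<in> ?A" for r unfolding a_def using that bdd by (rule cInf_lower)
      have a: "0 \<le> a" "a < 1"
        using False a_le unfolding a_def A by (auto intro!: cInf_greatest) (metis (no_types, lifting) le_less_trans)
      have up: "r \<in> ?A" if "a < r" "r < 1" for r
      proof -
        obtain s where s: "s \<in> ?A" "s < r" using \<open>a < r\<close> False bdd unfolding a_def by (meson cInf_less_iff)
        then have "\<phi> s \<le> \<phi> r" using that by (intro mono) (auto simp: A)
        then show ?thesis using s that unfolding A by auto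
      qed
      \<comment> \<open>\<open>a \<le> (1 + r) / 2\<close> means \<open>2 * a - 1 \<le> r\<close>;
        the maximum with 0 keeps \<open>b\<close> in the range of \<open>tail\<close>.\<close>
      define b where "b = max 0 (2 * a - 1)"
      have b: "0 \<le> b" "b < 1" "a \<le> (1 + b) / 2" using a by (auto simp: b_def)
      have "?B \<subseteq> {b..<1}"
      proof
        fix r assume r: "r \<in> ?B"
        then have "a \<le> (1 + r) / 2" by (intro a_le mem)
        then show "r \<in> {b..<1}" using r unfolding B b_def by auto
      qed
      then have "emeasure M ?B \<le> emeasure M {b..<1}" by (intro emeasure_mono) (auto simp: sets)
      also have "\<dots> \<le> C * emeasure M {(1 + b) / 2..<1}" using b by (intro tail)
      \<comment> \<open>The superlevel set may lack its left endpoint \<open>a\<close>; since points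
        have mass 0, adjoining it is free.\<close>
      also have "\<dots> \<le> C * emeasure M ({a} \<union> ?A)"
      proof (intro mult_left_mono emeasure_mono)
        show "{(1 + b) / 2..<1} \<subseteq> {a} \<union> ?A"
        proof
          fix r assume "r \<in> {(1 + b) / 2..<1}"
          then have "a \<le> r" "r < 1" using b by auto
          then show "r \<in> {a} \<union> ?A" using up[of r] by (cases "r = a") auto
        qed
        show "{a} \<union> ?A \<in> Sigma_Algebra.sets M" by (intro sets.Un) (auto simp: sets)
      qed auto
      also have "emeasure M ({a} \<union> ?A) \<le> emeasure M {a} + emeasure M ?A"
        by (intro emeasure_subadditive) (auto simp: sets)
      finally show ?thesis by (simp add: atom mult_left_mono order_trans)
    qed
  qed
  have "(\<integral>\<^sup>+r\<in>{0..<1}. \<phi> ((1 + r) / 2) \<partial>M) =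
      (\<integral>\<^sup>+t\<in>{0..}. emeasure M {r. ennreal t < \<phi> ((1 + r) / 2) * indicator {0..<1} r} \<partial>lborel)"
    by (subst nn_integral_layer_cake[OF assms(1)]) (auto simp: sp)
  also have "\<dots> \<le> (\<integral>\<^sup>+t. C * (emeasure M {r. ennreal t < \<phi> r * indicator {0..<1} r} * indicator {0..} t) \<partial>lborel)"
  proof (rule nn_integral_mono)
    fix t :: real
    show "emeasure M {r. ennreal t < \<phi> ((1 + r) / 2) * indicator {0..<1} r} * indicator {0..} t
       \<le> C * (emeasure M {r. ennreal t < \<phi> r * indicator {0..<1} r} * indicator {0..} t)"
      using level[of t] by (cases "0 \<le> t") (simp_all only: indicator_simps atLeast_iff mult_1_right mult_zero_right not_False_eq_True order_refl)
  qed
  also have "\<dots> = C * (\<integral>\<^sup>+t\<in>{0..}. emeasure M {r. ennreal t < \<phi> r * indicator {0..<1} r} \<partial>lborel)"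
  proof (rule nn_integral_cmult)
    interpret M: sigma_finite_measure M by fact
    have "(\<lambda>t. emeasure M {r \<in> space M. ennreal t < \<phi> r * indicator {0..<1} r}) \<in> borel_measurable lborel"
      by measurable
    then show "(\<lambda>t. emeasure M {r. ennreal t < \<phi> r * indicator {0..<1} r} * indicator {0..} t) \<in> borel_measurable lborel"
      unfolding sp by simp
  qed
  also have "(\<integral>\<^sup>+t\<in>{0..}. emeasure M {r. ennreal t < \<phi> r * indicator {0..<1} r} \<partial>lborel) = (\<integral>\<^sup>+r\<in>{0..<1}. \<phi> r \<partial>M)"
    by (subst nn_integral_layer_cake[OF assms(1)]) (auto simp: sp)
  finally show ?thesis .
qed

text \<open>The factor \<open>2 * s\<close> is at most 2 on \<open>{0..<1}\<close>, but at least 1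
  only from \<open>1/2\<close> on, since the Jacobian vanishes at the origin.\<close>

lemma radial_measure_tail:
  assumes [measurable]: "v \<in> borel_measurable borel" and v0: "\<And>r. 0 \<le> v r" and a: "0 \<le> a"
  shows "emeasure (radial_measure v) {a..<1} \<le> 2 * (\<integral>\<^sup>+s\<in>{a..<1}. ennreal (v s) \<partial>lborel)"
    and "1 / 2 \<le> a \<Longrightarrow> (\<integral>\<^sup>+s\<in>{a..<1}. ennreal (v s) \<partial>lborel) \<le> emeasure (radial_measure v) {a..<1}"
proof -
  have "emeasure (radial_measure v) {a..<1} =
      (\<integral>\<^sup>+s. ennreal (2 * s * v s) * indicator {0..<1} s * indicator {a..<1} s \<partial>lborel)"
    unfolding radial_measure_def by (subst emeasure_density) auto
  also have "\<dots> = (\<integral>\<^sup>+s. ennreal (2 * s * v s) * indicator {a..<1} s \<partial>lborel)"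
    using a by (intro nn_integral_cong) (auto simp: indicator_def)
  finally have eq: "emeasure (radial_measure v) {a..<1} = (\<integral>\<^sup>+s. ennreal (2 * s * v s) * indicator {a..<1} s \<partial>lborel)" .
  have "(\<integral>\<^sup>+s. ennreal (2 * s * v s) * indicator {a..<1} s \<partial>lborel) \<le>
      (\<integral>\<^sup>+s. 2 * (ennreal (v s) * indicator {a..<1} s) \<partial>lborel)"
  proof (rule nn_integral_mono)
    fix s
    have "ennreal (2 * s * v s) \<le> ennreal (2 * v s)" if "s < 1"
      using mult_right_mono[of s 1 "v s"] that v0[of s] by (intro ennreal_leI) auto
    then show "ennreal (2 * s * v s) * indicator {a..<1} s \<le> 2 * (ennreal (v s) * indicator {a..<1} s)"
      using v0[of s] by (auto simp: indicator_def ennreal_mult)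
  qed
  also have "\<dots> = 2 * (\<integral>\<^sup>+s\<in>{a..<1}. ennreal (v s) \<partial>lborel)"
    by (rule nn_integral_cmult) measurable
  finally show "emeasure (radial_measure v) {a..<1} \<le> 2 * (\<integral>\<^sup>+s\<in>{a..<1}. ennreal (v s) \<partial>lborel)"
    by (simp add: eq)
  assume a2: "1 / 2 \<le> a"
  show "(\<integral>\<^sup>+s\<in>{a..<1}. ennreal (v s) \<partial>lborel) \<le> emeasure (radial_measure v) {a..<1}"
    unfolding eq
  proof (rule nn_integral_mono)
    fix s
    have "ennreal (v s) \<le> ennreal (2 * s * v s)" if "a \<le> s"
      using mult_right_mono[of 1 "2 * s" "v s"] that v0[of s] a2 by (intro ennreal_leI) auto
    then show "ennreal (v s) * indicator {a..<1} s \<le> ennreal (2 * s * v s) * indicator {a..<1} s"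
      by (auto simp: indicator_def)
  qed
qed

lemma AE_radial_measure:
  assumes [measurable]: "v \<in> borel_measurable borel"
  shows "AE r in radial_measure v. 0 \<le> r \<and> r < 1"
  unfolding radial_measure_def by (subst AE_density) (auto simp: indicator_def)

lemma radial_measure_singleton:
  assumes [measurable]: "v \<in> borel_measurable borel"
  shows "emeasure (radial_measure v) {a} = 0"
proof -
  have "emeasure (radial_measure v) {a} = (\<integral>\<^sup>+r. ennreal (2 * r * v r) * indicator {0..<1} r * indicator {a} r \<partial>lborel)"
    unfolding radial_measure_def by (subst emeasure_density) auto
  also have "\<dots> = (\<integral>\<^sup>+r. 0 \<partial>(lborel :: real measure))"
    using AE_lborel_singleton[of a] by (intro nn_integral_cong_AE) (auto elim!: eventually_mono simp: indicator_def)
  finally show ?thesis by simp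
qed

lemma sigma_finite_radial_measure:
  assumes [measurable]: "v \<in> borel_measurable borel"
  shows "sigma_finite_measure (radial_measure v)"
  unfolding radial_measure_def
  by (subst sigma_finite_measure.sigma_finite_iff_density_finite[OF sigma_finite_lborel]) (auto simp: indicator_def ennreal_mult_eq_top_iff)

subsection \<open>Doubling weights\<close>

text \<open>Outside the disc \<open>f\<close> is arbitrary; the cut-off makes the function Borel on
  the whole plane.\<close>

definition disc_power :: "(complex \<Rightarrow> complex) \<Rightarrow> real \<Rightarrow> complex \<Rightarrow> ennreal" where
  "disc_power f p z = ennreal (cmod (f z) powr p) * indicator (ball 0 1) z"

lemma disc_power_measurable:
  assumes "f holomorphic_on ball 0 1" "0 < p"
  shows "disc_power f p \<in> borel_measurable borel"
  unfolding disc_power_def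
  by (rule borel_measurable_indicator_ball[OF continuous_on_cmod_powr[OF assms]])

lemma cmean_disc_power:
  assumes "f holomorphic_on ball 0 1" "0 < p" "cmod z < 1"
  shows "cmean (disc_power f p) z = ennreal (circ_mean (\<lambda>z. cmod (f z) powr p) z)"
  unfolding disc_power_def
  by (rule cmean_eq_circ_mean[OF continuous_on_cmod_powr[OF assms(1,2)] _ assms(3)]) simp

lemma cmean_disc_power_mono:
  assumes "f holomorphic_on ball 0 1" "0 < p" "cmod a \<le> R" "R < 1"
  shows "cmean (disc_power f p) a \<le> cmean (disc_power f p) (of_real R)"
proof -
  have "0 \<le> R" using assms(3) norm_ge_zero order_trans by blast
  then show ?thesis using assms circ_mean_powr_mono[OF assms]
    by (subst (1 2) cmean_disc_power) (auto intro: ennreal_leI)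
qed

text \<open>The 2 is that of \<open>powr_half_disc_bound\<close>; the rest is Cauchy's estimate for
  the \<open>j\<close>-th derivative on a disc of radius \<open>(1 - cmod z) / 4\<close>.\<close>

definition deriv_const :: "nat \<Rightarrow> real \<Rightarrow> real" where
  "deriv_const j p = 2 * (fact j * 4 ^ j) powr p"

lemma deriv_const_pos: "0 < deriv_const j p"
  by (simp add: deriv_const_def)

text \<open>The half-disc bound is applied about \<open>z\<close> with radius
  \<open>(1 - cmod z) / 2\<close>, then Cauchy's estimate with half of that. The unimodular
  \<open>c\<close> turns the small circle; later it is the phase of \<open>z\<close>, so that the
  configuration rotates rigidly with \<open>z\<close>.\<close>

lemma higher_deriv_powr_le_circ_mean:
  assumes f: "f holomorphic_on ball 0 1" and p: "0 < p" and z: "cmod z < 1" and c: "cmod c = 1"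
  shows "cmod ((deriv ^^ j) f z) powr p * (1 - cmod z) powr (real j * p)
    \<le> deriv_const j p * circ_mean (\<lambda>\<zeta>. cmod (f (z + c * \<zeta>)) powr p) (of_real ((1 - cmod z) / 2))"
proof -
  define s where "s = 1 - cmod z"
  have s: "0 < s" using z by (simp add: s_def)
  define M where "M = circ_mean (\<lambda>\<zeta>. cmod (f (z + c * \<zeta>)) powr p) (of_real (s / 2))"
  have M0: "0 \<le> M" unfolding M_def by (rule circ_mean_powr_nonneg)
  have inb: "z + c * \<zeta> \<in> ball 0 1" if "\<zeta> \<in> ball 0 s" for \<zeta>
    using norm_triangle_ineq[of z "c * \<zeta>"] that c by (simp add: s_def norm_mult)
  have g: "(\<lambda>\<zeta>. f (z + c * \<zeta>)) holomorphic_on ball 0 s"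
    by (rule holomorphic_on_compose_gen[OF _ f, unfolded o_def]) (auto intro!: holomorphic_intros simp: inb[simplified])
  have sub: "cball z (s / 4) \<subseteq> ball 0 1"
  proof
    fix x assume "x \<in> cball z (s / 4)"
    then show "x \<in> ball 0 1" using norm_triangle_ineq2[of x z] s by (simp add: s_def dist_norm norm_minus_commute)
  qed
  \<comment> \<open>Cauchy's estimate needs a bound on the modulus, so the bound on its
    \<open>p\<close>-th power is taken to the power \<open>1 / p\<close> and raised back
    afterwards.\<close>
  have "cmod ((deriv ^^ j) f z) \<le> fact j * (2 * M) powr (1 / p) / (s / 4) ^ j"
  proof (rule Cauchy_inequality)
    show "f holomorphic_on ball z (s / 4)" using f by (rule holomorphic_on_subset) (use sub ball_subset_cball in blast)
    show "continuous_on (cball z (s / 4)) f"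
      using holomorphic_on_imp_continuous_on[OF f] sub by (rule continuous_on_subset)
    show "0 < s / 4" using s by simp
    fix x assume x: "cmod (z - x) = s / 4"
    have cc: "c \<noteq> 0" using c by auto
    have "cmod (f (z + c * ((x - z) / c))) powr p \<le> 2 * M"
      unfolding M_def
      by (rule powr_half_disc_bound[OF g p]) (use s x c in \<open>auto simp: norm_divide norm_minus_commute\<close>)
    then have "cmod (f x) powr p \<le> 2 * M" using cc by simp
    then have "(cmod (f x) powr p) powr (1 / p) \<le> (2 * M) powr (1 / p)"
      using p by (intro powr_mono2) auto
    then show "cmod (f x) \<le> (2 * M) powr (1 / p)" using p by (simp add: powr_powr)
  qed
  then have "cmod ((deriv ^^ j) f z) powr p \<le> (fact j * (2 * M) powr (1 / p) / (s / 4) ^ j) powr p"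
    using p by (intro powr_mono2) auto
  also have "(fact j * (2 * M) powr (1 / p) / (s / 4) ^ j) = (fact j * 4 ^ j) * (2 * M) powr (1 / p) / s ^ j"
    by (simp add: power_divide)
  also have "\<dots> powr p = (fact j * 4 ^ j) powr p * (2 * M) / (s ^ j) powr p"
    using s p M0 by (simp add: powr_divide powr_mult powr_powr)
  also have "(s ^ j) powr p = s powr (real j * p)"
    using s by (simp add: powr_powr flip: powr_realpow)
  finally have "cmod ((deriv ^^ j) f z) powr p * s powr (real j * p) \<le> (fact j * 4 ^ j) powr p * (2 * M)"
    using s by (simp add: pos_le_divide_eq)
  then show ?thesis by (simp add: deriv_const_def M_def s_def mult_ac)
qed

lemma higher_deriv_powr_le_nn_integral:
  assumes f: "f holomorphic_on ball 0 1" and p: "0 < p" and z: "cmod z < 1" and c: "cmod c = 1"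
  shows "ennreal (cmod ((deriv ^^ j) f z) powr p * (1 - cmod z) powr (real j * p))
    \<le> ennreal (deriv_const j p) *
      (\<integral>\<^sup>+t\<in>{0..1}. disc_power f p (z + c * (of_real ((1 - cmod z) / 2) * ucirc t)) \<partial>lborel)"
proof -
  let ?s = "1 - cmod z"
  let ?G = "\<lambda>\<zeta>. cmod (f (z + c * \<zeta>)) powr p"
  have inb: "cmod (z + c * \<zeta>) < 1" if "cmod \<zeta> < ?s" for \<zeta>
    using norm_triangle_ineq[of z "c * \<zeta>"] that c by (simp add: norm_mult)
  have g: "(\<lambda>\<zeta>. f (z + c * \<zeta>)) holomorphic_on ball 0 ?s"
    by (rule holomorphic_on_compose_gen[OF _ f, unfolded o_def]) (auto intro!: holomorphic_intros simp: inb)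
  have "ennreal (circ_mean ?G (of_real (?s / 2))) =
      cmean (\<lambda>\<zeta>. ennreal (?G \<zeta>) * indicator (ball 0 ?s) \<zeta>) (of_real (?s / 2))"
  proof (rule cmean_eq_circ_mean[symmetric])
    show "continuous_on (ball 0 ?s) ?G" by (rule continuous_on_cmod_powr[OF g p])
    show "cmod (of_real (?s / 2)) < ?s" using z unfolding norm_of_real by simp
  qed simp
  also have "\<dots> = (\<integral>\<^sup>+t\<in>{0..1}. disc_power f p (z + c * (of_real (?s / 2) * ucirc t)) \<partial>lborel)"
    unfolding cmean_def
  proof (rule nn_integral_cong)
    fix t :: real
    have n: "cmod (of_real (?s / 2) * ucirc t) < ?s" using z unfolding norm_mult norm_of_real by simp
    show "ennreal (?G (of_real (?s / 2) * ucirc t)) * indicator (ball 0 ?s) (of_real (?s / 2) * ucirc t) * indicator {0..1} t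
       = disc_power f p (z + c * (of_real (?s / 2) * ucirc t)) * indicator {0..1} t"
      unfolding disc_power_def using n inb[OF n] by (simp only: mem_ball_0 indicator_simps)
  qed
  finally have eq: "ennreal (circ_mean ?G (of_real (?s / 2))) = \<dots>" .
  have "ennreal (cmod ((deriv ^^ j) f z) powr p * ?s powr (real j * p))
      \<le> ennreal (deriv_const j p * circ_mean ?G (of_real (?s / 2)))"
    by (rule ennreal_leI[OF higher_deriv_powr_le_circ_mean[OF assms]])
  also have "\<dots> = ennreal (deriv_const j p) * ennreal (circ_mean ?G (of_real (?s / 2)))"
    using deriv_const_pos[of j p] by (intro ennreal_mult') simp
  finally show ?thesis unfolding eq .
qed

text \<open>After exchanging the integrals, fixing the angle \<open>\<tau>\<close> on the small
  circle leaves a mean based at \<open>r + s * ucirc \<tau>\<close>. Its modulus is at most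
  \<open>r + s = (1 + r) / 2\<close>, so monotonicity of the means applies.\<close>

lemma cmean_higher_deriv_le:
  assumes f: "f holomorphic_on ball 0 1" and p: "0 < p" and r: "0 \<le> r" "r < 1"
  shows "cmean (disc_power ((deriv ^^ j) f) p) (of_real r) * ennreal ((1 - r) powr (real j * p))
    \<le> ennreal (deriv_const j p) * cmean (disc_power f p) (of_real ((1 + r) / 2))"
proof -
  let ?K = "ennreal (deriv_const j p)"
  let ?F = "disc_power f p"
  have fj: "(deriv ^^ j) f holomorphic_on ball 0 1" using f by (rule holomorphic_higher_deriv) simp
  note [measurable] = disc_power_measurable[OF f p] disc_power_measurable[OF fj p]
  define s where "s = (1 - r) / 2"
  have "cmean (disc_power ((deriv ^^ j) f) p) (of_real r) * ennreal ((1 - r) powr (real j * p)) =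
    (\<integral>\<^sup>+t. disc_power ((deriv ^^ j) f) p (of_real r * ucirc t) * indicator {0..1} t * ennreal ((1 - r) powr (real j * p)) \<partial>lborel)"
    unfolding cmean_def by (rule nn_integral_multc[symmetric]) measurable
  also have "\<dots> \<le> (\<integral>\<^sup>+t. ?K * ((\<integral>\<^sup>+\<tau>. ?F ((of_real r + of_real s * ucirc \<tau>) * ucirc t) * indicator {0..1} \<tau> * indicator {0..1} t \<partial>lborel)) \<partial>lborel)"
  proof (rule nn_integral_mono)
    fix t :: real
    let ?z = "of_real r * ucirc t"
    have z: "cmod ?z = r" using r by (simp add: norm_mult)
    have "disc_power ((deriv ^^ j) f) p ?z * ennreal ((1 - r) powr (real j * p)) =
       ennreal (cmod ((deriv ^^ j) f ?z) powr p * (1 - r) powr (real j * p))"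
      using r z by (simp add: disc_power_def ennreal_mult')
    also have "\<dots> \<le> ?K * (\<integral>\<^sup>+\<tau>\<in>{0..1}. ?F (?z + ucirc t * (of_real s * ucirc \<tau>)) \<partial>lborel)"
      using higher_deriv_powr_le_nn_integral[OF f p, of ?z "ucirc t" j] r unfolding z s_def by simp
    also have "(\<integral>\<^sup>+\<tau>\<in>{0..1}. ?F (?z + ucirc t * (of_real s * ucirc \<tau>)) \<partial>lborel) =
        (\<integral>\<^sup>+\<tau>\<in>{0..1}. ?F ((of_real r + of_real s * ucirc \<tau>) * ucirc t) \<partial>lborel)"
      by (rule arg_cong[of _ _ "nn_integral lborel"]) (simp add: algebra_simps)
    finally show "disc_power ((deriv ^^ j) f) p ?z * indicator {0..1} t * ennreal ((1 - r) powr (real j * p)) \<le>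
      ?K * (\<integral>\<^sup>+\<tau>. ?F ((of_real r + of_real s * ucirc \<tau>) * ucirc t) * indicator {0..1} \<tau> * indicator {0..1} t \<partial>lborel)"
      by (cases "t \<in> {0..1}") simp_all
  qed
  also have "\<dots> = ?K * (\<integral>\<^sup>+t. (\<integral>\<^sup>+\<tau>. ?F ((of_real r + of_real s * ucirc \<tau>) * ucirc t) * indicator {0..1} \<tau> * indicator {0..1} t \<partial>lborel) \<partial>lborel)"
    by (rule nn_integral_cmult) measurable
  also have "(\<integral>\<^sup>+t. (\<integral>\<^sup>+\<tau>. ?F ((of_real r + of_real s * ucirc \<tau>) * ucirc t) * indicator {0..1} \<tau> * indicator {0..1} t \<partial>lborel) \<partial>lborel) =
    (\<integral>\<^sup>+\<tau>. (\<integral>\<^sup>+t. ?F ((of_real r + of_real s * ucirc \<tau>) * ucirc t) * indicator {0..1} \<tau> * indicator {0..1} t \<partial>lborel) \<partial>lborel)"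
    by (rule lborel_pair.Fubini') measurable
  also have "\<dots> \<le> (\<integral>\<^sup>+\<tau>. cmean ?F (of_real ((1 + r) / 2)) * indicator {0..1::real} \<tau> \<partial>lborel)"
  proof (rule nn_integral_mono)
    fix \<tau> :: real
    have "0 \<le> s" "r + s = (1 + r) / 2" using r by (auto simp: s_def field_simps)
    then have "cmod (of_real r + of_real s * ucirc \<tau>) \<le> (1 + r) / 2"
      using norm_triangle_ineq[of "of_real r" "of_real s * ucirc \<tau>"] r by (simp add: norm_mult)
    then have "cmean ?F (of_real r + of_real s * ucirc \<tau>) \<le> cmean ?F (of_real ((1 + r) / 2))"
      using r by (intro cmean_disc_power_mono[OF f p]) auto
    then show "(\<integral>\<^sup>+t. ?F ((of_real r + of_real s * ucirc \<tau>) * ucirc t) * indicator {0..1} \<tau> * indicator {0..1} t \<partial>lborel)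
       \<le> cmean ?F (of_real ((1 + r) / 2)) * indicator {0..1} \<tau>"
      by (cases "\<tau> \<in> {0..1}") (simp_all add: cmean_def)
  qed
  also have "\<dots> = cmean ?F (of_real ((1 + r) / 2))"
    by (subst nn_integral_cmult) auto
  finally show ?thesis by (simp add: mult_left_mono)
qed

lemma higher_deriv_zero_le:
  assumes f: "f holomorphic_on ball 0 1" and p: "0 < p"
  shows "ennreal (cmod ((deriv ^^ j) f 0) powr p) \<le> ennreal (deriv_const j p) * cmean (disc_power f p) (1 / 2)"
  using higher_deriv_powr_le_nn_integral[OF f p, of 0 1 j] by (simp add: cmean_def)

text \<open>Doubling handles the integral through \<open>nn_integral_midpoint_le\<close>. The values
  at 0 use \<open>m\<close>: means at radii beyond \<open>1/2\<close> dominate the one at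
  \<open>1/2\<close>, so that mean times \<open>m\<close> is at most the full integral.\<close>

lemma tail_doubling_imp_bound:
  assumes "sigma_finite_measure M" and sets[measurable_cong]: "sets M = sets borel"
    and conc: "AE r in M. 0 \<le> r \<and> r < 1"
    and atom: "\<And>a. emeasure M {a} = 0"
    and tail: "\<And>a. 0 \<le> a \<Longrightarrow> a < 1 \<Longrightarrow> emeasure M {a..<1} \<le> ennreal D * emeasure M {(1 + a) / 2..<1}"
    and D: "0 \<le> D" and m: "0 < m" "ennreal m \<le> emeasure M {1/2..<1}"
    and f: "f holomorphic_on ball 0 1" and p: "0 < p"
  shows "(\<integral>\<^sup>+r. cmean (disc_power ((deriv ^^ k) f) p) (of_real r) * ennreal ((1 - r) powr (real k * p)) \<partial>M)
      + ennreal (\<Sum>j<k. cmod ((deriv ^^ j) f 0) powr p)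
      \<le> ennreal (deriv_const k p * D + (\<Sum>j<k. deriv_const j p) / m) * (\<integral>\<^sup>+r. cmean (disc_power f p) (of_real r) \<partial>M)"
proof -
  define \<phi> where "\<phi> r = cmean (disc_power f p) (of_real r)" for r
  define I where "I = (\<integral>\<^sup>+r. \<phi> r \<partial>M)"
  note [measurable] = disc_power_measurable[OF f p]
  have \<phi>_meas[measurable]: "\<phi> \<in> borel_measurable borel" unfolding \<phi>_def by measurable
  have mono: "\<phi> r \<le> \<phi> s" if "0 \<le> r" "r \<le> s" "s < 1" for r s
    unfolding \<phi>_def using that by (intro cmean_disc_power_mono[OF f p]) auto
  have I_eq: "I = (\<integral>\<^sup>+r\<in>{0..<1}. \<phi> r \<partial>M)"
    unfolding I_def
  proof (rule nn_integral_cong_AE)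
    show "AE r in M. \<phi> r = \<phi> r * indicator {0..<1} r" using conc by eventually_elim simp
  qed
  have "(\<integral>\<^sup>+r. cmean (disc_power ((deriv ^^ k) f) p) (of_real r) * ennreal ((1 - r) powr (real k * p)) \<partial>M)
     \<le> (\<integral>\<^sup>+r. ennreal (deriv_const k p) * (\<phi> ((1 + r) / 2) * indicator {0..<1} r) \<partial>M)"
  proof (rule nn_integral_mono_AE)
    show "AE r in M. cmean (disc_power ((deriv ^^ k) f) p) (of_real r) * ennreal ((1 - r) powr (real k * p))
        \<le> ennreal (deriv_const k p) * (\<phi> ((1 + r) / 2) * indicator {0..<1} r)"
      using conc
    proof eventually_elim
      case (elim r)
      then show ?case using cmean_higher_deriv_le[OF f p, of r k] unfolding \<phi>_def by simp
    qed
  qed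
  also have "\<dots> = ennreal (deriv_const k p) * (\<integral>\<^sup>+r\<in>{0..<1}. \<phi> ((1 + r) / 2) \<partial>M)"
    by (rule nn_integral_cmult) measurable
  also have "\<dots> \<le> ennreal (deriv_const k p) * (ennreal D * I)"
    unfolding I_eq
    by (intro mult_left_mono nn_integral_midpoint_le[OF assms(1) sets \<phi>_meas mono atom tail]) auto
  also have "\<dots> = ennreal (deriv_const k p * D) * I"
    using D deriv_const_pos[of k p] by (simp add: ennreal_mult mult.assoc)
  finally have 1: "(\<integral>\<^sup>+r. cmean (disc_power ((deriv ^^ k) f) p) (of_real r) * ennreal ((1 - r) powr (real k * p)) \<partial>M)
     \<le> ennreal (deriv_const k p * D) * I" .
  have "\<phi> (1/2) * ennreal m \<le> \<phi> (1/2) * emeasure M {1/2..<1}" using m by (intro mult_left_mono) auto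
  also have "\<dots> = (\<integral>\<^sup>+r. \<phi> (1/2) * indicator {1/2..<1} r \<partial>M)"
    by (rule nn_integral_cmult_indicator[symmetric]) (simp add: sets)
  also have "\<dots> \<le> I"
    unfolding I_def by (intro nn_integral_mono) (auto simp: indicator_def mono)
  finally have "ennreal (1 / m) * (\<phi> (1/2) * ennreal m) \<le> ennreal (1 / m) * I" by (intro mult_left_mono) auto
  moreover have "ennreal (1 / m) * (\<phi> (1/2) * ennreal m) = \<phi> (1/2) * (ennreal (1 / m) * ennreal m)"
    by (simp only: mult_ac)
  moreover have "ennreal (1 / m) * ennreal m = 1"
    using m by (subst ennreal_mult[symmetric]) auto
  ultimately have half: "\<phi> (1/2) \<le> ennreal (1 / m) * I" by simp
  have "ennreal (\<Sum>j<k. cmod ((deriv ^^ j) f 0) powr p) = (\<Sum>j<k. ennreal (cmod ((deriv ^^ j) f 0) powr p))"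
    by (rule sum_ennreal[symmetric]) simp
  also have "\<dots> \<le> (\<Sum>j<k. ennreal (deriv_const j p) * \<phi> (1/2))"
    using higher_deriv_zero_le[OF f p] by (intro sum_mono) (simp add: \<phi>_def)
  also have "\<dots> = ennreal (\<Sum>j<k. deriv_const j p) * \<phi> (1/2)"
    using deriv_const_pos by (simp add: sum_ennreal less_imp_le flip: sum_distrib_right)
  also have "\<dots> \<le> ennreal (\<Sum>j<k. deriv_const j p) * (ennreal (1 / m) * I)"
    by (intro mult_left_mono half) auto
  also have "\<dots> = ennreal ((\<Sum>j<k. deriv_const j p) / m) * I"
    using m deriv_const_pos by (simp add: mult.assoc[symmetric] ennreal_mult[symmetric] sum_nonneg less_imp_le)
  finally have 2: "ennreal (\<Sum>j<k. cmod ((deriv ^^ j) f 0) powr p) \<le> ennreal ((\<Sum>j<k. deriv_const j p) / m) * I" .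
  have "ennreal (deriv_const k p * D) * I + ennreal ((\<Sum>j<k. deriv_const j p) / m) * I =
     ennreal (deriv_const k p * D + (\<Sum>j<k. deriv_const j p) / m) * I"
    using m D deriv_const_pos by (subst ennreal_plus) (auto simp: distrib_right sum_nonneg less_imp_le)
  with add_mono[OF 1 2] show ?thesis unfolding I_def \<phi>_def by simp
qed

subsection \<open>Necessity of doubling\<close>

text \<open>The 4 combines the half of the moment kept right of \<open>1 - A / n\<close> with the 2
  in \<open>up\<close>; \<open>exp (8 * A * p)\<close> bounds the inverse of
  \<open>(r ^ n) powr p\<close> at \<open>r = 1 - 4 * A / n\<close>. The condition on
  \<open>n\<close> keeps this point at or above \<open>1/2\<close>, where \<open>low\<close>
  holds.\<close>

lemma moment_step:
  fixes M :: "real measure" and T :: "real \<Rightarrow> real"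
  assumes sets[measurable_cong]: "sets M = sets borel"
    and up: "\<And>a. 0 \<le> a \<Longrightarrow> a < 1 \<Longrightarrow> emeasure M {a..<1} \<le> ennreal (2 * T a)"
    and low: "\<And>a. 1 / 2 \<le> a \<Longrightarrow> a < 1 \<Longrightarrow> ennreal (T a) \<le> emeasure M {a..<1}"
    and pos: "\<And>a. 0 \<le> a \<Longrightarrow> a < 1 \<Longrightarrow> 0 < T a"
    and p: "0 < p" and C: "0 < C" and A: "0 < A" "2 * C \<le> ((A / 2) ^ k) powr p" and n: "8 * A \<le> real n"
    and bound: "(\<integral>\<^sup>+r\<in>{0..<1}. ennreal ((r ^ n * (real n / 2 * (1 - r)) ^ k) powr p) \<partial>M)
      \<le> ennreal C * (\<integral>\<^sup>+r\<in>{0..<1}. ennreal ((r ^ n) powr p) \<partial>M)"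
  shows "T (1 - 4 * A / n) \<le> 4 * exp (8 * A * p) * T (1 - A / n)"
proof -
  define a where "a = 1 - A / n"
  define b where "b = 1 - 4 * A / n"
  have n0: "0 < real n" using A n by linarith
  have ab: "1 / 2 \<le> b" "b < a" "a < 1"
    using n0 A n by (simp_all add: a_def b_def field_simps)
  define J1 where "J1 = (\<integral>\<^sup>+r\<in>{0..<a}. ennreal ((r ^ n) powr p) \<partial>M)"
  define J2 where "J2 = (\<integral>\<^sup>+r\<in>{a..<1}. ennreal ((r ^ n) powr p) \<partial>M)"
  define I where "I = (\<integral>\<^sup>+r\<in>{0..<1}. ennreal ((r ^ n) powr p) \<partial>M)"
  have "I = (\<integral>\<^sup>+r. ennreal ((r ^ n) powr p) * indicator {0..<a} r + ennreal ((r ^ n) powr p) * indicator {a..<1} r \<partial>M)"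
    unfolding I_def using ab by (intro nn_integral_cong) (auto simp: indicator_def)
  also have "\<dots> = J1 + J2"
    unfolding J1_def J2_def by (rule nn_integral_add) measurable
  finally have I: "I = J1 + J2" .
  have le1: "(r ^ n) powr p \<le> 1" if "0 \<le> r" "r < 1" for r :: real
    using that p power_le_one[of r n] powr_mono2[of p "r ^ n" 1] by simp
  have mass: "(\<integral>\<^sup>+r\<in>{c..<1}. ennreal ((r ^ n) powr p) \<partial>M) \<le> emeasure M {c..<1}" if "0 \<le> c" for c
  proof -
    have "(\<integral>\<^sup>+r\<in>{c..<1}. ennreal ((r ^ n) powr p) \<partial>M) \<le> (\<integral>\<^sup>+r. indicator {c..<1} r \<partial>M)"
    proof (rule nn_integral_mono)
      fix r show "ennreal ((r ^ n) powr p) * indicator {c..<1} r \<le> indicator {c..<1} r"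
        using le1[of r] that by (auto simp: indicator_def)
    qed
    then show ?thesis by (simp add: sets)
  qed
  have J2: "J2 \<le> ennreal (2 * T a)"
    unfolding J2_def using mass[of a] up[of a] ab by auto
  have "I \<le> ennreal (2 * T 0)"
    unfolding I_def using mass[of 0] up[of 0] by auto
  \<comment> \<open>Finiteness of both parts is what permits subtracting \<open>j1\<close>
    below.\<close>
  then obtain j1 j2 where j: "0 \<le> j1" "0 \<le> j2" "J1 = ennreal j1" "J2 = ennreal j2"
    unfolding I by (cases J1; cases J2) (auto simp: top_unique)
  have "ennreal (2 * C) * J1 \<le> ennreal C * I"
  proof -
    have "ennreal (2 * C) * J1 = (\<integral>\<^sup>+r. ennreal (2 * C) * (ennreal ((r ^ n) powr p) * indicator {0..<a} r) \<partial>M)"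
      unfolding J1_def by (rule nn_integral_cmult[symmetric]) measurable
    also have "\<dots> \<le> (\<integral>\<^sup>+r\<in>{0..<1}. ennreal ((r ^ n * (real n / 2 * (1 - r)) ^ k) powr p) \<partial>M)"
    proof (rule nn_integral_mono)
      fix r
      show "ennreal (2 * C) * (ennreal ((r ^ n) powr p) * indicator {0..<a} r)
        \<le> ennreal ((r ^ n * (real n / 2 * (1 - r)) ^ k) powr p) * indicator {0..<1} r"
      proof (cases "r \<in> {0..<a}")
        case True
        \<comment> \<open>Left of \<open>a\<close> the derivative factor is at least
          \<open>((A / 2) ^ k) powr p\<close>, which \<open>A\<close> makes as large as
          \<open>2 * C\<close>.\<close>
        then have "A / n \<le> 1 - r" by (simp add: a_def)
        then have "A / 2 \<le> real n / 2 * (1 - r)" using n0 by (simp add: field_simps)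
        then have "((A / 2) ^ k) powr p \<le> ((real n / 2 * (1 - r)) ^ k) powr p"
          using A p by (intro powr_mono2 power_mono) auto
        then have "2 * C \<le> ((real n / 2 * (1 - r)) ^ k) powr p" using A by linarith
        then have "2 * C * (r ^ n) powr p \<le> ((real n / 2 * (1 - r)) ^ k) powr p * (r ^ n) powr p"
          by (rule mult_right_mono) simp
        also have "\<dots> = (r ^ n * (real n / 2 * (1 - r)) ^ k) powr p"
          using True ab by (subst powr_mult) (auto intro!: zero_le_power)
        finally have "ennreal (2 * C * (r ^ n) powr p) \<le> ennreal ((r ^ n * (real n / 2 * (1 - r)) ^ k) powr p)"
          by (rule ennreal_leI)
        then show ?thesis using True ab C by (simp add: ennreal_mult)
      qed simp
    qed
    finally show ?thesis using bound unfolding I_def by (rule order_trans)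
  qed
  then have "2 * C * j1 \<le> C * (j1 + j2)"
    unfolding I j using j C by (simp add: ennreal_mult[symmetric] ennreal_plus[symmetric] del: ennreal_plus)
  then have "j1 \<le> j2" using C by (simp add: algebra_simps)
  then have "I \<le> ennreal (2 * j2)" unfolding I j using j by (simp add: ennreal_plus[symmetric] ennreal_leI del: ennreal_plus)
  also have "\<dots> \<le> ennreal (4 * T a)" using J2 j pos[of a] ab by (intro ennreal_leI) (simp add: ennreal_le_iff)
  finally have I_le: "I \<le> ennreal (4 * T a)" .
  have "ennreal ((b ^ n) powr p * T b) = ennreal ((b ^ n) powr p) * ennreal (T b)"
    by (rule ennreal_mult') simp
  also have "\<dots> \<le> ennreal ((b ^ n) powr p) * emeasure M {b..<1}"
    using low[of b] ab by (intro mult_left_mono) auto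
  also have "\<dots> = (\<integral>\<^sup>+r. ennreal ((b ^ n) powr p) * indicator {b..<1} r \<partial>M)"
    by (rule nn_integral_cmult_indicator[symmetric]) (simp add: sets)
  also have "\<dots> \<le> I"
    unfolding I_def
  proof (rule nn_integral_mono)
    fix r show "ennreal ((b ^ n) powr p) * indicator {b..<1} r \<le> ennreal ((r ^ n) powr p) * indicator {0..<1} r"
      using ab p by (auto simp: indicator_def intro!: ennreal_leI powr_mono2 power_mono)
  qed
  also note I_le
  finally have main: "(b ^ n) powr p * T b \<le> 4 * T a" using pos[of a] ab by (simp add: ennreal_le_iff)
  have "exp (- (8 * A * p)) \<le> (b ^ n) powr p"
  proof -
    define y where "y = 4 * A / n"
    have y: "0 \<le> y" "y \<le> 1 / 2" "b = 1 - y" "n * y = 4 * A" using A n0 n by (auto simp: y_def b_def field_simps)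
    \<comment> \<open>For \<open>0 \<le> y \<le> 1/2\<close> this yields
      \<open>1 - y \<ge> exp (- 2 * y)\<close>; its \<open>n\<close>-th power is bounded below
      independently of \<open>n\<close> because \<open>n * y = 4 * A\<close>.\<close>
    have "y * y \<le> 1 / 2 * y" using y by (intro mult_right_mono)
    then have "1 \<le> (1 - y) * (1 + 2 * y)" by (simp add: algebra_simps)
    then have "1 \<le> b * (1 + 2 * y)" using y(3) by simp
    also have "\<dots> \<le> b * exp (2 * y)" using ab by (intro mult_left_mono exp_ge_add_one_self) auto
    finally have "exp (- (2 * y)) \<le> b" by (simp add: exp_minus field_simps)
    then have "exp (- (2 * y)) ^ n \<le> b ^ n" by (rule power_mono) simp
    also have "exp (- (2 * y)) ^ n = exp (n * (- (2 * y)))" by (rule exp_of_nat_mult[symmetric])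
    also have "n * (- (2 * y)) = - (8 * A)" using y(4) by (simp add: mult.commute)
    finally have "exp (- (8 * A)) powr p \<le> (b ^ n) powr p" using p by (intro powr_mono2) auto
    then show ?thesis by (simp add: powr_def mult.commute)
  qed
  then have "exp (- (8 * A * p)) * T b \<le> 4 * T a"
    using main mult_right_mono[of "exp (- (8 * A * p))" "(b ^ n) powr p" "T b"] pos[of b] ab by linarith
  then show ?thesis unfolding a_def[symmetric] b_def[symmetric] by (simp add: exp_minus field_simps)
qed

lemma moment_bound_imp_doubling:
  fixes M :: "real measure" and T :: "real \<Rightarrow> real"
  assumes sets: "sets M = sets borel"
    and up: "\<And>a. 0 \<le> a \<Longrightarrow> a < 1 \<Longrightarrow> emeasure M {a..<1} \<le> ennreal (2 * T a)"
    and low: "\<And>a. 1 / 2 \<le> a \<Longrightarrow> a < 1 \<Longrightarrow> ennreal (T a) \<le> emeasure M {a..<1}"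
    and pos: "\<And>a. 0 \<le> a \<Longrightarrow> a < 1 \<Longrightarrow> 0 < T a"
    and anti: "\<And>a b. 0 \<le> a \<Longrightarrow> a \<le> b \<Longrightarrow> b < 1 \<Longrightarrow> T b \<le> T a"
    and p: "0 < p" and k: "1 \<le> k" and C: "0 < C"
    and bound: "\<And>n. 2 * k \<le> n \<Longrightarrow> (\<integral>\<^sup>+r\<in>{0..<1}. ennreal ((r ^ n * (real n / 2 * (1 - r)) ^ k) powr p) \<partial>M)
      \<le> ennreal C * (\<integral>\<^sup>+r\<in>{0..<1}. ennreal ((r ^ n) powr p) \<partial>M)"
  shows "\<exists>D\<ge>1. \<forall>r\<in>{0..<1}. T r \<le> D * T ((1 + r) / 2)"
proof -
  \<comment> \<open>Solves \<open>((A / 2) ^ k) powr p = 2 * C + 1\<close>; the extra 1 also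
    guarantees \<open>A \<ge> 2\<close>.\<close>
  define A where "A = 2 * (2 * C + 1) powr (1 / (real k * p))"
  have "1 \<le> A / 2" using C p by (simp add: A_def ge_one_powr_ge_zero)
  then have A: "2 \<le> A" by simp
  have "((A / 2) ^ k) powr p = (A / 2) powr (real k * p)"
    using A by (simp add: powr_powr flip: powr_realpow)
  also have "\<dots> = 2 * C + 1" using C p k by (simp add: A_def powr_powr)
  finally have AC: "2 * C \<le> ((A / 2) ^ k) powr p" by simp
  \<comment> \<open>\<open>8 * A\<close> is demanded by \<open>moment_step\<close> and
    \<open>2 * real k\<close> by \<open>bound\<close>; for \<open>r < 1\<close>, the condition
    \<open>r0 \<le> r\<close> says \<open>N \<le> 2 * A / (1 - r)\<close>.\<close>
  define N where "N = max (8 * A) (2 * real k)"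
  define r0 where "r0 = 1 - 2 * A / N"
  have N: "8 * A \<le> N" "2 * real k \<le> N" "0 < N" using A by (auto simp: N_def)
  have r0: "0 \<le> r0" "r0 < 1" using N A by (auto simp: r0_def field_simps)
  define D1 where "D1 = 4 * exp (8 * A * p)"
  \<comment> \<open>Away from 1 monotonicity suffices: for \<open>r < r0\<close> the tail at
    \<open>r\<close> is at most \<open>T 0\<close> and the tail at \<open>(1 + r) / 2\<close> at
    least \<open>T ((1 + r0) / 2)\<close>.\<close>
  define D2 where "D2 = T 0 / T ((1 + r0) / 2)"
  have D2: "0 < D2" using pos r0 by (simp add: D2_def)
  have D1: "0 < D1" by (simp add: D1_def)
  have large: "T r \<le> D1 * T ((1 + r) / 2)" if r: "r0 \<le> r" "r < 1" for r
  proof -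
    \<comment> \<open>Any integer \<open>n\<close> between \<open>x\<close> and \<open>2 * x\<close>
      gives \<open>1 - 4 * A / n \<le> r\<close> and \<open>(1 + r) / 2 \<le> 1 - A / n\<close>;
      rounding up stays in this range as \<open>x \<ge> 1\<close>.\<close>
    define x where "x = 2 * A / (1 - r)"
    have "2 * A / N \<ge> 1 - r" using r by (simp add: r0_def)
    then have xN: "N \<le> x" using N r by (simp add: x_def field_simps)
    define n where "n = nat \<lceil>x\<rceil>"
    have x1: "1 \<le> x" using xN N A by linarith
    have n: "x \<le> real n" "real n \<le> 2 * x" unfolding n_def using x1 by linarith+
    have n0: "0 < real n" using n x1 by linarith
    have nk: "2 * k \<le> n" using n(1) xN N(2) by linarith
    have r1: "0 < 1 - r" using r by simp
    have "1 - 4 * A / n \<le> r"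
      using n(2) n0 r1 by (simp add: x_def field_simps)
    moreover have "(1 + r) / 2 \<le> 1 - A / n"
      using n(1) n0 r1 by (simp add: x_def field_simps)
    moreover have "0 \<le> 1 - 4 * A / n" using n(1) xN N n0 A by (simp add: field_simps)
    moreover have "T (1 - 4 * A / n) \<le> D1 * T (1 - A / n)"
      unfolding D1_def
      by (rule moment_step[OF sets up low pos p C _ AC _ bound[OF nk]]) (use A n xN N in auto)
    moreover have "A / n > 0" using A n0 by simp
    ultimately have "T r \<le> T (1 - 4 * A / n)" "T (1 - A / n) \<le> T ((1 + r) / 2)"
      using r r0 by (auto intro!: anti)
    then show ?thesis
      using \<open>T (1 - 4 * A / n) \<le> D1 * T (1 - A / n)\<close> mult_left_mono[of "T (1 - A / n)" "T ((1 + r) / 2)" D1] D1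
      by linarith
  qed
  have small: "T r \<le> D2 * T ((1 + r) / 2)" if r: "0 \<le> r" "r < r0" for r
  proof -
    have "T r \<le> T 0" using r r0 by (intro anti) auto
    also have "\<dots> = D2 * T ((1 + r0) / 2)" using pos[of "(1 + r0) / 2"] r0 by (simp add: D2_def)
    also have "\<dots> \<le> D2 * T ((1 + r) / 2)" using r r0 D2 by (intro mult_left_mono anti) auto
    finally show ?thesis .
  qed
  show ?thesis
  proof (intro exI[of _ "1 + D1 + D2"] conjI ballI)
    show "1 \<le> 1 + D1 + D2" using D1 D2 by simp
    fix r :: real assume r: "r \<in> {0..<1}"
    have T: "0 < T ((1 + r) / 2)" using r by (intro pos) auto
    have "0 < D1 * T ((1 + r) / 2)" "0 < D2 * T ((1 + r) / 2)" using D1 D2 T by simp_all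
    then show "T r \<le> (1 + D1 + D2) * T ((1 + r) / 2)"
      using large[of r] small[of r] r T by (cases "r0 \<le> r") (auto simp: distrib_right)
  qed
qed

section \<open>Monomials as test functions and the equivalence\<close>

lemma cmean_disc_power_monomial:
  assumes "0 \<le> r" "r < 1"
  shows "cmean (disc_power (\<lambda>z. c * z ^ m) p) (of_real r) = ennreal ((cmod c * r ^ m) powr p)"
  using assms by (simp add: cmean_def disc_power_def norm_mult norm_power nn_integral_cmult)

text \<open>Each of the \<open>k\<close> factors is at least \<open>x\<close>; this bounds the
  coefficient of a differentiated monomial from below.\<close>

lemma norm_pochhammer_ge:
  assumes "0 \<le> x"
  shows "x ^ k \<le> cmod (pochhammer (of_real x) k)"
proof (induction k)
  case (Suc k)
  have "cmod (of_real x + of_nat k) = x + k"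
    using assms norm_of_real[of "x + real k", where 'a=complex] by simp
  moreover have "x ^ k * x \<le> cmod (pochhammer (of_real x) k) * (x + k)"
    using Suc assms by (intro mult_mono) auto
  ultimately show ?case by (simp add: pochhammer_Suc norm_mult mult.commute)
qed simp

theorem theorem6:
  fixes w :: "real \<Rightarrow> real" and p :: real and k :: nat
  assumes "radial_weight w" and "0 < p" and "1 \<le> k"
  shows "(\<exists>C::real. C > 0 \<and>
            (\<forall>f. f holomorphic_on ball 0 1 \<longrightarrow>
               (\<integral>\<^sup>+z\<in>ball 0 1.
                   ennreal (cmod ((deriv ^^ k) f z) powr p * (1 - cmod z) powr (real k * p) * w (cmod z))
                 \<partial>area_measure)
               + ennreal (\<Sum>j<k. cmod ((deriv ^^ j) f 0) powr p)
               \<le> ennreal C * bergman_norm_p w p f))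
         \<longleftrightarrow> upper_doubling w"
proof -
  obtain v where v[measurable]: "v \<in> borel_measurable borel" and v0: "\<And>r. 0 \<le> v r"
    and conv: "\<And>F. F \<in> borel_measurable borel \<Longrightarrow>
       (\<integral>\<^sup>+z\<in>ball 0 1. F z * ennreal (w (cmod z)) \<partial>area_measure) = (\<integral>\<^sup>+r. cmean F (of_real r) \<partial>radial_measure v)"
    and tail: "\<And>a. 0 \<le> a \<Longrightarrow> ennreal (weight_tail w a) = (\<integral>\<^sup>+s\<in>{a..<1}. ennreal (v s) \<partial>lborel)"
    using radial_weight_borel_version[OF assms(1)] by auto
  define M where "M = radial_measure v"
  define T where "T = weight_tail w"
  have sets: "sets M = sets borel" by (simp add: M_def)
  have conc: "AE r in M. 0 \<le> r \<and> r < 1" unfolding M_def by (rule AE_radial_measure) fact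
  have pos: "0 < T a" if "0 \<le> a" "a < 1" for a
  proof -
    have "\<forall>z\<in>ball (0::complex) 1. 0 < weight_tail w (cmod z)" using assms(1) by (simp add: radial_weight_def)
    from bspec[OF this, of "of_real a"] show ?thesis using that by (simp add: T_def)
  qed
  have up: "emeasure M {a..<1} \<le> ennreal (2 * T a)" if "0 \<le> a" "a < 1" for a
    using radial_measure_tail(1)[OF v v0 that(1)] tail[OF that(1)] pos[OF that]
    by (simp add: M_def T_def ennreal_mult)
  have low: "ennreal (T a) \<le> emeasure M {a..<1}" if "1 / 2 \<le> a" "a < 1" for a
    using radial_measure_tail(2)[OF v v0, of a] tail[of a] that by (simp add: M_def T_def)
  have anti: "T b \<le> T a" if "0 \<le> a" "a \<le> b" "b < 1" for a b
  proof -
    have "ennreal (T b) \<le> ennreal (T a)"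
      unfolding T_def using that by (simp add: tail) (intro nn_integral_mono, auto simp: indicator_def)
    then show ?thesis using pos[of a] that by (simp add: ennreal_le_iff)
  qed
  have norm_eq: "bergman_norm_p w p f = (\<integral>\<^sup>+r. cmean (disc_power f p) (of_real r) \<partial>M)"
    if f: "f holomorphic_on ball 0 1" for f
  proof -
    have "bergman_norm_p w p f = (\<integral>\<^sup>+z\<in>ball 0 1. disc_power f p z * ennreal (w (cmod z)) \<partial>area_measure)"
      unfolding bergman_norm_p_def disc_power_def
      by (intro nn_integral_cong) (auto simp: indicator_def ennreal_mult')
    then show ?thesis using conv[OF disc_power_measurable[OF f assms(2)]] by (simp add: M_def)
  qed
  have int_eq: "(\<integral>\<^sup>+z\<in>ball 0 1. ennreal (cmod (g z) powr p * (1 - cmod z) powr q * w (cmod z)) \<partial>area_measure)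
      = (\<integral>\<^sup>+r. cmean (disc_power g p) (of_real r) * ennreal ((1 - r) powr q) \<partial>M)"
    if g: "g holomorphic_on ball 0 1" for g q
  proof -
    note [measurable] = disc_power_measurable[OF g assms(2)]
    let ?F = "\<lambda>z. disc_power g p z * ennreal ((1 - cmod z) powr q)"
    have "(\<integral>\<^sup>+z\<in>ball 0 1. ennreal (cmod (g z) powr p * (1 - cmod z) powr q * w (cmod z)) \<partial>area_measure)
      = (\<integral>\<^sup>+z\<in>ball 0 1. ?F z * ennreal (w (cmod z)) \<partial>area_measure)"
      unfolding disc_power_def
      by (intro nn_integral_cong) (auto simp: indicator_def ennreal_mult')
    also have "\<dots> = (\<integral>\<^sup>+r. cmean ?F (of_real r) \<partial>M)" unfolding M_def by (rule conv) measurable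
    also have "\<dots> = (\<integral>\<^sup>+r. cmean (disc_power g p) (of_real r) * ennreal ((1 - r) powr q) \<partial>M)"
    proof (rule nn_integral_cong_AE)
      show "AE r in M. cmean ?F (of_real r) = cmean (disc_power g p) (of_real r) * ennreal ((1 - r) powr q)"
        using conc
      proof eventually_elim
        case (elim r)
        \<comment> \<open>On a circle \<open>cmod\<close> is constant, so the distance factor leaves
          the mean.\<close>
        have "cmean ?F (of_real r) = (\<integral>\<^sup>+t. disc_power g p (of_real r * ucirc t) * indicator {0..1} t * ennreal ((1 - r) powr q) \<partial>lborel)"
          unfolding cmean_def using elim by (intro nn_integral_cong) (simp add: norm_mult mult_ac)
        also have "\<dots> = cmean (disc_power g p) (of_real r) * ennreal ((1 - r) powr q)"
          unfolding cmean_def by (rule nn_integral_multc) measurable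
        finally show ?case .
      qed
    qed
    finally show ?thesis .
  qed
  have hd: "(deriv ^^ k) f holomorphic_on ball 0 1" if "f holomorphic_on ball 0 1" for f
    using that by (rule holomorphic_higher_deriv) simp
  show ?thesis
  proof
    assume "upper_doubling w"
    then obtain D where D: "D \<ge> 1" "\<And>r. 0 \<le> r \<Longrightarrow> r < 1 \<Longrightarrow> T r \<le> D * T ((1 + r) / 2)"
      unfolding upper_doubling_def T_def by auto
    have tl: "emeasure M {a..<1} \<le> ennreal (2 * D) * emeasure M {(1 + a) / 2..<1}" if a: "0 \<le> a" "a < 1" for a
    proof -
      have "emeasure M {a..<1} \<le> ennreal (2 * T a)" by (rule up[OF a])
      also have "\<dots> \<le> ennreal (2 * D * T ((1 + a) / 2))" using D(2)[OF a] by (intro ennreal_leI) simp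
      also have "\<dots> = ennreal (2 * D) * ennreal (T ((1 + a) / 2))" using D(1) by (intro ennreal_mult') simp
      also have "\<dots> \<le> ennreal (2 * D) * emeasure M {(1 + a) / 2..<1}"
        using a by (intro mult_left_mono low) auto
      finally show ?thesis .
    qed
    \<comment> \<open>The 2 in \<open>2 * D\<close> is the one in \<open>up\<close>;
      \<open>T (1 / 2)\<close> bounds the mass of \<open>{1/2..<1}\<close> from below.\<close>
    let ?C = "deriv_const k p * (2 * D) + (\<Sum>j<k. deriv_const j p) / T (1 / 2)"
    have "0 < ?C" using D(1) deriv_const_pos pos[of "1/2"]
      by (intro add_pos_nonneg mult_pos_pos divide_nonneg_pos sum_nonneg) (auto simp: less_imp_le)
    moreover have "(\<integral>\<^sup>+z\<in>ball 0 1. ennreal (cmod ((deriv ^^ k) f z) powr p * (1 - cmod z) powr (real k * p) * w (cmod z)) \<partial>area_measure)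
               + ennreal (\<Sum>j<k. cmod ((deriv ^^ j) f 0) powr p) \<le> ennreal ?C * bergman_norm_p w p f"
      if f: "f holomorphic_on ball 0 1" for f
      unfolding int_eq[OF hd[OF f]] norm_eq[OF f]
      by (rule tail_doubling_imp_bound[OF _ sets conc _ tl _ _ _ f assms(2)])
         (use D pos[of "1/2"] low[of "1/2"] in \<open>auto simp: M_def sigma_finite_radial_measure radial_measure_singleton\<close>)
    ultimately show "\<exists>C::real. C > 0 \<and> (\<forall>f. f holomorphic_on ball 0 1 \<longrightarrow>
               (\<integral>\<^sup>+z\<in>ball 0 1. ennreal (cmod ((deriv ^^ k) f z) powr p * (1 - cmod z) powr (real k * p) * w (cmod z)) \<partial>area_measure)
               + ennreal (\<Sum>j<k. cmod ((deriv ^^ j) f 0) powr p) \<le> ennreal C * bergman_norm_p w p f)"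
      by blast
  next
    assume "\<exists>C::real. C > 0 \<and> (\<forall>f. f holomorphic_on ball 0 1 \<longrightarrow>
               (\<integral>\<^sup>+z\<in>ball 0 1. ennreal (cmod ((deriv ^^ k) f z) powr p * (1 - cmod z) powr (real k * p) * w (cmod z)) \<partial>area_measure)
               + ennreal (\<Sum>j<k. cmod ((deriv ^^ j) f 0) powr p) \<le> ennreal C * bergman_norm_p w p f)"
    then obtain C where C: "0 < C" and bd: "\<And>f. f holomorphic_on ball 0 1 \<Longrightarrow>
               (\<integral>\<^sup>+z\<in>ball 0 1. ennreal (cmod ((deriv ^^ k) f z) powr p * (1 - cmod z) powr (real k * p) * w (cmod z)) \<partial>area_measure)
               + ennreal (\<Sum>j<k. cmod ((deriv ^^ j) f 0) powr p) \<le> ennreal C * bergman_norm_p w p f"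
      by blast
    have "\<exists>D\<ge>1. \<forall>r\<in>{0..<1}. T r \<le> D * T ((1 + r) / 2)"
    proof (rule moment_bound_imp_doubling[OF sets up low pos anti assms(2,3) C])
      fix n assume n: "2 * k \<le> n"
      \<comment> \<open>The factor 1 keeps the shape \<open>c * z ^ m\<close> of
        \<open>cmean_disc_power_monomial\<close>.\<close>
      let ?f = "\<lambda>z::complex. 1 * z ^ n"
      let ?c = "pochhammer (of_nat (Suc n - k)) k :: complex"
      have hol: "?f holomorphic_on ball 0 1" by (intro holomorphic_intros)
      have der: "(deriv ^^ k) ?f = (\<lambda>z. ?c * z ^ (n - k))"
        using higher_deriv_power[of k "0::complex" n] by (simp add: fun_eq_iff)
      \<comment> \<open>\<open>?c\<close> is \<open>n * (n - 1) * ... * (n - k + 1)\<close>, and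
        \<open>2 * k \<le> n\<close> makes its smallest factor at least
        \<open>n / 2\<close>.\<close>
      have c: "(real n / 2) ^ k \<le> cmod ?c"
      proof -
        have "real n / 2 \<le> real (Suc n - k)" using n by (simp add: of_nat_diff)
        then have "(real n / 2) ^ k \<le> real (Suc n - k) ^ k" by (intro power_mono) auto
        also have "\<dots> \<le> cmod ?c" using norm_pochhammer_ge[of "real (Suc n - k)" k] by simp
        finally show ?thesis .
      qed
      have "(\<integral>\<^sup>+r\<in>{0..<1}. ennreal ((r ^ n * (real n / 2 * (1 - r)) ^ k) powr p) \<partial>M)
        \<le> (\<integral>\<^sup>+r. cmean (disc_power ((deriv ^^ k) ?f) p) (of_real r) * ennreal ((1 - r) powr (real k * p)) \<partial>M)"
      proof (rule nn_integral_mono)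
        fix r :: real
        show "ennreal ((r ^ n * (real n / 2 * (1 - r)) ^ k) powr p) * indicator {0..<1} r
          \<le> cmean (disc_power ((deriv ^^ k) ?f) p) (of_real r) * ennreal ((1 - r) powr (real k * p))"
        proof (cases "0 \<le> r \<and> r < 1")
          case True
          \<comment> \<open>Giving up \<open>r ^ k\<close> lets the same power \<open>r ^ n\<close>
            appear on both sides of the moment inequality.\<close>
          have "r ^ n \<le> r ^ (n - k)" using True by (intro power_decreasing) auto
          then have "(real n / 2) ^ k * r ^ n \<le> cmod ?c * r ^ (n - k)"
            using c True by (intro mult_mono) auto
          then have "(real n / 2) ^ k * r ^ n * (1 - r) ^ k \<le> cmod ?c * r ^ (n - k) * (1 - r) ^ k"
            using True by (intro mult_right_mono) auto
          moreover have "r ^ n * (real n / 2 * (1 - r)) ^ k = (real n / 2) ^ k * r ^ n * (1 - r) ^ k"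
            by (simp only: power_mult_distrib mult_ac)
          ultimately have "r ^ n * (real n / 2 * (1 - r)) ^ k \<le> cmod ?c * r ^ (n - k) * (1 - r) ^ k"
            by (simp only:)
          then have "(r ^ n * (real n / 2 * (1 - r)) ^ k) powr p \<le> (cmod ?c * r ^ (n - k) * (1 - r) ^ k) powr p"
            using assms(2) True by (intro powr_mono2) auto
          also have "\<dots> = (cmod ?c * r ^ (n - k)) powr p * ((1 - r) ^ k) powr p"
            by (rule powr_mult)
          also have "((1 - r) ^ k) powr p = (1 - r) powr (real k * p)"
            using True by (simp add: powr_powr flip: powr_realpow)
          finally have "ennreal ((r ^ n * (real n / 2 * (1 - r)) ^ k) powr p) \<le>
              ennreal ((cmod ?c * r ^ (n - k)) powr p * (1 - r) powr (real k * p))" by (rule ennreal_leI)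
          then show ?thesis unfolding der using True by (simp add: cmean_disc_power_monomial ennreal_mult')
        qed (auto simp: indicator_def)
      qed
      \<comment> \<open>The nonnegative sum of values at 0 is dropped from the assumed
        inequality.\<close>
      also have "\<dots> \<le> ennreal C * bergman_norm_p w p ?f"
        using bd[OF hol] unfolding int_eq[OF hd[OF hol]] by (rule order_trans[rotated]) simp
      also have "bergman_norm_p w p ?f = (\<integral>\<^sup>+r\<in>{0..<1}. ennreal ((r ^ n) powr p) \<partial>M)"
        unfolding norm_eq[OF hol]
      proof (rule nn_integral_cong_AE)
        show "AE r in M. cmean (disc_power ?f p) (of_real r) = ennreal ((r ^ n) powr p) * indicator {0..<1} r"
          using conc
        proof eventually_elim
          case (elim r)
          then show ?case by (subst cmean_disc_power_monomial) auto
        qed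
      qed
      finally show "(\<integral>\<^sup>+r\<in>{0..<1}. ennreal ((r ^ n * (real n / 2 * (1 - r)) ^ k) powr p) \<partial>M)
        \<le> ennreal C * (\<integral>\<^sup>+r\<in>{0..<1}. ennreal ((r ^ n) powr p) \<partial>M)" .
    qed
    then show "upper_doubling w" unfolding upper_doubling_def T_def by simp
  qed
qed

end
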